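(* Let $W=(W_t)_{t\ge 0}$ be a standard one-dimensional Brownian motion (with $W_0=0$) on a probability space $(\Omega,\mathcal F,\mathbb P)$. Let $f\in C^3(\mathbb R)$ be a real-valued function such that $f''$ is uniformly bounded on $\mathbb R$, $\sup_{x\in\mathbb R} f''(x)<1$, and $f'''$ is Lipschitz continuous. Define $u:[0,1]\times\mathbb R\to\mathbb R$ by $u(t,x):=\mathbb E[f(x+W_{1-t})]$. For $n\in\mathbb N$ set $$S_n := f(W_1)-u(0,0)-\sum_{k=0}^{n-1} u_x\!\left(\tfrac{k}{n},W_{\frac{k}{n}}\right)\left(W_{\frac{k+1}{n}}-W_{\frac{k}{n}}\right).$$ Define $\Psi:(-\infty,1)\to\mathbb R_+$ and $g:[0,1]\to\mathbb R_+$ by $$\Psi(z)=\frac{-z-\log(1-z)}{2},\qquad g(t):=\sup_{x\in\mathbb R}\Psi\bigl(u_{xx}(t,x)\bigr).$$ Then $$\lim_{n\to\infty}\frac1n\log\mathbb E\!\left[e^{\,nS_n}\right]=\int_0^1 g(t)\,dt.$$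
   Context: Subscripts $x$, $xx$ denote first and second partial derivatives in the spatial variable $x$. Explicitly, $u(t,x)=\mathbb E[f(x+W_{1-t})]=\frac{1}{\sqrt{2\pi}}\int_{\mathbb R} f(x+\sqrt{1-t}\,y)e^{-y^2/2}\,dy$ for $(t,x)\in[0,1]\times\mathbb R$; in particular $u(1,x)=f(x)$, and $u$ solves the heat equation $u_t+\frac12 u_{xx}=0$. $\mathbb R_+=[0,\infty)$, $\mathbb N=\{1,2,\dots\}$, and $\log$ is the natural logarithm. *)

theory Defs
  imports "HOL-Probability.Probability"
begin

text \<open>Only the times \<open>t \<ge> 0\<close> are constrained; \<open>W t\<close> is arbitrary for negative \<open>t\<close>.
  The parameter of \<open>normal_density\<close> is the standard deviation, not the variance.\<close>

locale standard_brownian_motion = prob_space M for M :: "'a measure" +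
  fixes W :: "real \<Rightarrow> 'a \<Rightarrow> real"
  assumes random_variable_W: "\<And>t. 0 \<le> t \<Longrightarrow> random_variable borel (W t)"
    and start_zero: "AE \<omega> in M. W 0 \<omega> = 0"
    and indep_increments:
      "\<And>(n::nat) t. \<lbrakk>0 \<le> t 0; \<forall>i<n. t i \<le> t (Suc i)\<rbrakk> \<Longrightarrow>
         indep_vars (\<lambda>_. borel) (\<lambda>i \<omega>. W (t (Suc i)) \<omega> - W (t i) \<omega>) {..<n}"
    and gaussian_increments:
      "\<And>s t. \<lbrakk>0 \<le> s; s < t\<rbrakk> \<Longrightarrow>
         distributed M lborel (\<lambda>\<omega>. W t \<omega> - W s \<omega>) (normal_density 0 (sqrt (t - s)))"
    and continuous_paths: "AE \<omega> in M. continuous_on {0..} (\<lambda>t. W t \<omega>)"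

definition C_class :: "nat \<Rightarrow> (real \<Rightarrow> real) \<Rightarrow> bool" where
  "C_class k f \<longleftrightarrow>
     (\<forall>i<k. \<forall>x. (deriv ^^ i) f field_differentiable at x) \<and>
     continuous_on UNIV ((deriv ^^ k) f)"

definition u :: "'a measure \<Rightarrow> (real \<Rightarrow> 'a \<Rightarrow> real) \<Rightarrow> (real \<Rightarrow> real) \<Rightarrow> real \<Rightarrow> real \<Rightarrow> real" where
  "u M W f t x = (\<integral>\<omega>. f (x + W (1 - t) \<omega>) \<partial>M)"

definition u_x :: "'a measure \<Rightarrow> (real \<Rightarrow> 'a \<Rightarrow> real) \<Rightarrow> (real \<Rightarrow> real) \<Rightarrow> real \<Rightarrow> real \<Rightarrow> real" where
  "u_x M W f t = deriv (u M W f t)"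

definition u_xx :: "'a measure \<Rightarrow> (real \<Rightarrow> 'a \<Rightarrow> real) \<Rightarrow> (real \<Rightarrow> real) \<Rightarrow> real \<Rightarrow> real \<Rightarrow> real" where
  "u_xx M W f t = deriv (u_x M W f t)"

definition S :: "'a measure \<Rightarrow> (real \<Rightarrow> 'a \<Rightarrow> real) \<Rightarrow> (real \<Rightarrow> real) \<Rightarrow> nat \<Rightarrow> 'a \<Rightarrow> real" where
  "S M W f n \<omega> = f (W 1 \<omega>) - u M W f 0 0 -
     (\<Sum>k<n. u_x M W f (real k / real n) (W (real k / real n) \<omega>) *
        (W (real (k + 1) / real n) \<omega> - W (real k / real n) \<omega>))"

text \<open>\<open>\<Psi>\<close> is meaningful only for arguments below \<open>1\<close>.\<close>

definition \<Psi> :: "real \<Rightarrow> real" where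
  "\<Psi> z = (- z - ln (1 - z)) / 2"

definition g :: "'a measure \<Rightarrow> (real \<Rightarrow> 'a \<Rightarrow> real) \<Rightarrow> (real \<Rightarrow> real) \<Rightarrow> real \<Rightarrow> real" where
  "g M W f t = (SUP x. \<Psi> (u_xx M W f t x))"

end

theory Submission
  imports Defs "HOL-Real_Asymp.Real_Asymp"
begin

text \<open>The martingale property of \<open>u (t, W t)\<close> turns \<open>n S\<^sub>n\<close> into a sum of \<open>n\<close> one-step hedging errors.
  By Taylor expansion the error of a step that starts at \<open>x\<close> at time \<open>t\<close> and has normalised Gaussian
  increment \<open>y\<close> is \<open>z (y\<^sup>2 - 1) / 2\<close> up to \<open>O(n\<^sup>-\<^sup>1\<^sup>/\<^sup>2)\<close>, where \<open>z = u_xx (t, x)\<close>, and its conditional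
  exponential moment is \<open>exp (\<Psi> z)\<close>. Bounding each factor by its supremum over \<open>x\<close> gives the upper
  bound. For the lower bound, the Brownian path is confined to a tube of fixed small width around a
  Lipschitz path that follows near-maximisers of \<open>\<Psi> (u_xx (t, x))\<close>. The confinement costs a
  factor \<open>1 - O(n\<^sup>-\<^sup>1\<^sup>/\<^sup>2)\<close> per step, which is negligible at scale \<open>n\<close>: a tent function of the
  distance to the centre of the tube is a subsolution of the backward recursion up to this factor.\<close>

section \<open>Gaussian integrals\<close>

text \<open>The sharp one-step error is of size \<open>a * exp \<bar>y\<bar>\<close> with a =
  n^(-1/2). It cannot be exponentiated, because exp (a exp |y|) has infinite Gaussian mean. Each
  step therefore carries a second, cruder bound whose quadratic part is c y^2 / 2. Since c < 1,
  which is where sup f'' < 1 enters, that bound gives an integrable majorant, and the sharp error is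
  only used linearly against it. The estimates have to be uniform in time, space and n. They are
  stated for the class \<open>bounded_C2 K c B\<close>, whose constants survive Gaussian averaging,
  so every u (t, .) belongs to it with the constants of f. Then n errors of order n^(-1/2) in the
  exponent add up to order n^(1/2), which disappears after division by n. Following a path is
  equally cheap: the centre of the tube moves by O(1/n) per step, which is only O(n^(-1/2)) standard
  deviations of an increment. Path and tube radius are fixed before n grows, so the constants may
  depend on both.\<close>

abbreviation gauss :: "real measure" where
  "gauss \<equiv> density lborel (\<lambda>x. ennreal (std_normal_density x))"

interpretation gauss: prob_space gauss
  by (rule prob_space_normal_density) simp

lemma gauss_affine:
  assumes "a > 0"
  shows "distr gauss borel (\<lambda>y. a * y) = density lborel (normal_density 0 a)"
proof -
  have "distributed gauss lborel (\<lambda>y. y) std_normal_density"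
    by (auto simp: distributed_def distr_id2)
  from gauss.normal_density_affine[OF this, of a 0] assms
  have "distributed gauss lborel (\<lambda>y. a * y) (normal_density 0 a)"
    by simp
  then have "distr gauss lborel (\<lambda>y. a * y) = density lborel (normal_density 0 a)"
    by (rule distributed_distr_eq_density)
  moreover have "distr gauss lborel (\<lambda>y. a * y) = distr gauss borel (\<lambda>y. a * y)"
    by (intro distr_cong) auto
  ultimately show ?thesis by simp
qed

text \<open>Stability of centred normal laws under independent sums. The law of the sum is a
  convolution of two densities, for which the closed form is known.\<close>

lemma gauss_convolution:
  assumes "a > 0" "b > 0"
  shows "distr (gauss \<Otimes>\<^sub>M gauss) borel (\<lambda>z. a * fst z + b * snd z)
    = distr gauss borel (\<lambda>y. sqrt (a\<^sup>2 + b\<^sup>2) * y)"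
proof -
  interpret P: pair_sigma_finite gauss gauss ..
  let ?A = "distr gauss borel (\<lambda>y. a * y)" and ?B = "distr gauss borel (\<lambda>y. b * y)"
  have pos: "sqrt (a\<^sup>2 + b\<^sup>2) > 0"
    using assms by (simp add: sum_power2_gt_zero_iff)
  have sB: "sigma_finite_measure ?B"
    by (intro prob_space_imp_sigma_finite gauss.prob_space_distr) auto
  have "distr (gauss \<Otimes>\<^sub>M gauss) borel (\<lambda>z. a * fst z + b * snd z)
      = distr (distr (gauss \<Otimes>\<^sub>M gauss) (borel \<Otimes>\<^sub>M borel) (\<lambda>(x, y). (a * x, b * y)))
          borel (\<lambda>(x, y). x + y)"
    by (subst distr_distr) (auto simp: comp_def case_prod_beta)
  also have "distr (gauss \<Otimes>\<^sub>M gauss) (borel \<Otimes>\<^sub>M borel) (\<lambda>(x, y). (a * x, b * y)) = ?A \<Otimes>\<^sub>M ?B"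
    by (subst pair_measure_distr) (auto intro: sB)
  also have "distr (?A \<Otimes>\<^sub>M ?B) borel (\<lambda>(x, y). x + y) = (?A \<star> ?B)"
    by (simp add: convolution_def)
  also have "\<dots> = (density lborel (normal_density 0 a) \<star> density lborel (normal_density 0 b))"
    using assms by (simp add: gauss_affine)
  also have "\<dots> = density lborel (\<lambda>x. \<integral>\<^sup>+y. ennreal (normal_density 0 a (x - y)) * ennreal (normal_density 0 b y) \<partial>lborel)"
    using assms
    by (intro convolution_density)
       (auto intro!: prob_space.finite_measure prob_space_normal_density)
  also have "\<dots> = density lborel (normal_density 0 (sqrt (a\<^sup>2 + b\<^sup>2)))"
    using conv_normal_density_zero_mean[OF assms]
    by (simp add: ennreal_mult)
  also have "\<dots> = distr gauss borel (\<lambda>y. sqrt (a\<^sup>2 + b\<^sup>2) * y)"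
    using gauss_affine[OF pos] by simp
  finally show ?thesis .
qed

lemma integral_gauss:
  fixes F :: "real \<Rightarrow> real"
  assumes [measurable]: "F \<in> borel_measurable borel"
  shows "integral\<^sup>L gauss F = (\<integral>y. std_normal_density y * F y \<partial>lborel)"
  by (subst integral_density) auto

lemma integrable_gauss:
  fixes F :: "real \<Rightarrow> real"
  assumes [measurable]: "F \<in> borel_measurable borel"
  shows "integrable gauss F \<longleftrightarrow> integrable lborel (\<lambda>y. std_normal_density y * F y)"
  by (subst integrable_density) auto

lemma gauss_mean: "integral\<^sup>L gauss (\<lambda>y. y) = 0"
  and gauss_second_moment: "integral\<^sup>L gauss (\<lambda>y. y\<^sup>2) = 1"
  using integral_std_normal_moment_odd[of 0] integral_std_normal_moment_even[of 1]
  by (simp_all add: integral_gauss)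

lemma gauss_exp_square:
  assumes "z < 1"
  shows "integrable gauss (\<lambda>y. exp (z * y\<^sup>2 / 2))"
    and "(\<integral>y. exp (z * y\<^sup>2 / 2) \<partial>gauss) = 1 / sqrt (1 - z)"
proof -
  \<comment> \<open>Tilting by exp (z y^2 / 2) turns the variance 1 into 1 / (1 - z);
    \<open>s\<close> is the new standard deviation and also the total mass.\<close>
  define s where "s = 1 / sqrt (1 - z)"
  have s: "s > 0" using assms by (simp add: s_def)
  have eq: "std_normal_density y * exp (z * y\<^sup>2 / 2) = s * normal_density 0 s y" for y
  proof -
    have s2: "s\<^sup>2 = 1 / (1 - z)" using assms by (simp add: s_def power_divide)
    have "exp (- y\<^sup>2 / 2) * exp (z * y\<^sup>2 / 2) = exp (- y\<^sup>2 / (2 * s\<^sup>2))"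
      unfolding mult_exp_exp s2 using assms by (simp add: field_simps)
    then show ?thesis
      using s by (simp add: normal_density_def std_normal_density_def real_sqrt_mult)
  qed
  show "integrable gauss (\<lambda>y. exp (z * y\<^sup>2 / 2))"
    using s by (simp add: integrable_gauss eq)
  show "(\<integral>y. exp (z * y\<^sup>2 / 2) \<partial>gauss) = 1 / sqrt (1 - z)"
    using s by (simp add: integral_gauss eq s_def)
qed

lemma gauss_exp_quadratic:
  assumes "c < 1"
  shows "integrable gauss (\<lambda>y. exp (a * \<bar>y\<bar> + c * y\<^sup>2 / 2))"
proof -
  \<comment> \<open>Half of the gap between c and 1 is spent on absorbing the linear term through a
    |y| <= a^2 / (2e) + e y^2 / 2.\<close>
  define e where "e = (1 - c) / 2"
  have e: "e > 0" "c + e < 1" using assms by (auto simp: e_def field_simps)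
  have "a * \<bar>y\<bar> + c * y\<^sup>2 / 2 \<le> a\<^sup>2 / (2 * e) + (c + e) * y\<^sup>2 / 2" for y
  proof -
    have "0 \<le> (a - e * \<bar>y\<bar>)\<^sup>2 / (2 * e)" using e by simp
    also have "\<dots> = a\<^sup>2 / (2 * e) - a * \<bar>y\<bar> + e * y\<^sup>2 / 2"
      using e by (simp add: power2_eq_square field_simps)
    finally show ?thesis by (simp add: field_simps)
  qed
  then have "exp (a * \<bar>y\<bar> + c * y\<^sup>2 / 2) \<le> exp (a\<^sup>2 / (2 * e)) * exp ((c + e) * y\<^sup>2 / 2)" for y
    unfolding mult_exp_exp by simp
  then show ?thesis
    by (intro Bochner_Integration.integrable_bound[OF
          integrable_mult_right[OF gauss_exp_square(1)[OF e(2)], of "exp (a\<^sup>2 / (2 * e))"]])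
       auto
qed

lemma gauss_exp_abs: "integrable gauss (\<lambda>y. exp (a * \<bar>y\<bar>))"
  using gauss_exp_quadratic[of 0 a] by simp

text \<open>The origin of \<open>\<Psi>\<close>: the centring of y^2 contributes -z/2, and the mass
  1 / sqrt (1 - z) contributes -ln (1 - z) / 2.\<close>

lemma gauss_quadratic_mgf:
  assumes "z < 1"
  shows "integrable gauss (\<lambda>y. exp (z * (y\<^sup>2 - 1) / 2))"
    and "(\<integral>y. exp (z * (y\<^sup>2 - 1) / 2) \<partial>gauss) = exp (\<Psi> z)"
proof -
  have eq: "exp (z * (y\<^sup>2 - 1) / 2) = exp (- z / 2) * exp (z * y\<^sup>2 / 2)" for y
    unfolding mult_exp_exp by (simp add: field_simps)
  show "integrable gauss (\<lambda>y. exp (z * (y\<^sup>2 - 1) / 2))"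
    unfolding eq by (intro integrable_mult_right gauss_exp_square assms)
  have "sqrt (1 - z) = exp (ln (1 - z) / 2)"
    using assms by (simp flip: ln_sqrt)
  then have "exp (\<Psi> z) = exp (- z / 2) / sqrt (1 - z)"
    by (simp add: \<Psi>_def exp_diff[symmetric] diff_divide_distrib)
  then show "(\<integral>y. exp (z * (y\<^sup>2 - 1) / 2) \<partial>gauss) = exp (\<Psi> z)"
    unfolding eq using gauss_exp_square(2)[OF assms] by simp
qed

section \<open>The heat semigroup\<close>

lemma gauss_prob_UNIV [simp]: "measure gauss UNIV = 1"
  using gauss.prob_space by simp

text \<open>The heat semigroup at time a^2, parametrised by standard deviation. Writing it over one
  fixed Gaussian variable makes a = 0 harmless and allows different scales to be compared under the
  same integral.\<close>

definition smooth :: "real \<Rightarrow> (real \<Rightarrow> real) \<Rightarrow> real \<Rightarrow> real" where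
  "smooth a F x = (\<integral>y. F (x + a * y) \<partial>gauss)"

text \<open>A class that contains the quadratically growing payoff and its derivatives and still has
  finite Gaussian averages at every scale, as needed for Fubini.\<close>

definition exp_growth :: "(real \<Rightarrow> real) \<Rightarrow> bool" where
  "exp_growth F \<longleftrightarrow> continuous_on UNIV F \<and> (\<exists>C. \<forall>x. \<bar>F x\<bar> \<le> C * exp \<bar>x\<bar>)"

lemma exp_growth_measurable: "exp_growth F \<Longrightarrow> F \<in> borel_measurable borel"
  by (simp add: exp_growth_def borel_measurable_continuous_onI)

lemma exp_growth_integrable:
  assumes "exp_growth F"
  shows "integrable gauss (\<lambda>y. F (x + a * y))"
proof -
  note [measurable] = exp_growth_measurable[OF assms]
  obtain C where C: "\<bar>F x\<bar> \<le> C * exp \<bar>x\<bar>" for x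
    using assms by (auto simp: exp_growth_def)
  have C0: "C \<ge> 0" using C[of 0] by simp
  have "\<bar>F (x + a * y)\<bar> \<le> C * exp \<bar>x\<bar> * exp (\<bar>a\<bar> * \<bar>y\<bar>)" for y
  proof -
    have "\<bar>F (x + a * y)\<bar> \<le> C * exp \<bar>x + a * y\<bar>" by (rule C)
    also have "\<dots> \<le> C * exp (\<bar>x\<bar> + \<bar>a\<bar> * \<bar>y\<bar>)"
      using C0 abs_triangle_ineq[of x "a * y"]
      by (intro mult_left_mono) (auto simp: abs_mult)
    finally show ?thesis by (simp add: exp_add mult_ac)
  qed
  then show ?thesis
    using C0 by (intro Bochner_Integration.integrable_bound[OF
      integrable_mult_right[OF gauss_exp_abs[of "\<bar>a\<bar>"], of "C * exp \<bar>x\<bar>"]]) auto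
qed

lemma smooth_0 [simp]: "smooth 0 F x = F x"
  by (simp add: smooth_def)

text \<open>Semigroup property: by Fubini both sides integrate F (x + s) against the law of a y + b
  y' with independent standard normal y and y'. The case b = 0 is separate because the convolution
  formula needs two genuine densities.\<close>

lemma smooth_smooth:
  assumes "exp_growth F" "a > 0" "b \<ge> 0"
  shows "smooth a (smooth b F) x = smooth (sqrt (a\<^sup>2 + b\<^sup>2)) F x"
proof (cases "b = 0")
  case True
  moreover have "smooth 0 F = F" by (rule ext) simp
  ultimately show ?thesis using assms by simp
next
  case False
  then have b: "b > 0" using assms by simp
  interpret P: pair_sigma_finite gauss gauss ..
  note [measurable] = exp_growth_measurable[OF assms(1)]
  let ?D = "distr (gauss \<Otimes>\<^sub>M gauss) borel (\<lambda>z. a * fst z + b * snd z)"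
  have D: "?D = distr gauss borel (\<lambda>y. sqrt (a\<^sup>2 + b\<^sup>2) * y)"
    by (rule gauss_convolution[OF assms(2) b])
  have "integrable ?D (\<lambda>s. F (x + s))"
    unfolding D by (subst integrable_distr_eq) (auto intro: exp_growth_integrable[OF assms(1)])
  then have int: "integrable (gauss \<Otimes>\<^sub>M gauss) (\<lambda>z. F (x + (a * fst z + b * snd z)))"
    by (subst (asm) integrable_distr_eq) auto
  have "smooth (sqrt (a\<^sup>2 + b\<^sup>2)) F x = (\<integral>s. F (x + s) \<partial>?D)"
    unfolding D smooth_def by (subst integral_distr) auto
  also have "\<dots> = (\<integral>z. F (x + (a * fst z + b * snd z)) \<partial>(gauss \<Otimes>\<^sub>M gauss))"
    by (subst integral_distr) auto
  also have "\<dots> = (\<integral>y. \<integral>y'. F (x + (a * y + b * y')) \<partial>gauss \<partial>gauss)"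
    using P.integral_fst'[OF int] by simp
  also have "\<dots> = smooth a (smooth b F) x"
    by (simp add: smooth_def add.assoc)
  finally show ?thesis by simp
qed

text \<open>The bound \<open>K\<close> controls remainders, whereas the one-sided bound
  \<open>c\<close> decides whether exponential moments are finite; they must be kept apart. The
  derivatives are explicit arguments so that averaging can act on all three functions at
  once.\<close>

definition bounded_C2 :: "real \<Rightarrow> real \<Rightarrow> real \<Rightarrow> (real \<Rightarrow> real) \<Rightarrow> (real \<Rightarrow> real) \<Rightarrow> (real \<Rightarrow> real) \<Rightarrow> bool" where
  "bounded_C2 K c B q q1 q2 \<longleftrightarrow>
     (\<forall>x. (q has_field_derivative q1 x) (at x)) \<and>
     (\<forall>x. (q1 has_field_derivative q2 x) (at x)) \<and>
     (\<forall>x. \<bar>q2 x\<bar> \<le> K) \<and> (\<forall>x. q2 x \<le> c) \<and> (\<forall>x y. \<bar>q2 x - q2 y\<bar> \<le> B * \<bar>x - y\<bar>)"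

lemma bounded_C2D:
  assumes "bounded_C2 K c B q q1 q2"
  shows "(q has_field_derivative q1 x) (at x)" "(q1 has_field_derivative q2 x) (at x)"
    "\<bar>q2 x\<bar> \<le> K" "q2 x \<le> c" "\<bar>q2 x - q2 y\<bar> \<le> B * \<bar>x - y\<bar>" "0 \<le> K" "0 \<le> B"
proof -
  show "0 \<le> K" using assms by (auto simp: bounded_C2_def intro: order_trans[OF abs_ge_zero])
  have "\<bar>q2 0 - q2 1\<bar> \<le> B * \<bar>0 - 1\<bar>" using assms unfolding bounded_C2_def by blast
  then show "0 \<le> B" by simp
qed (use assms in \<open>auto simp: bounded_C2_def\<close>)

lemma bounded_C2_taylor:
  assumes "bounded_C2 K c B q q1 q2"
  shows "\<exists>t. \<bar>t\<bar> \<le> \<bar>s\<bar> \<and> q (x + s) = q x + q1 x * s + q2 (x + t) * s\<^sup>2 / 2"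
    and "\<exists>t. \<bar>t\<bar> \<le> \<bar>s\<bar> \<and> q1 (x + s) = q1 x + q2 (x + t) * s"
proof -
  define d where "d = (\<lambda>m::nat. if m = 0 then q else if m = 1 then q1 else q2)"
  have "\<exists>t. \<bar>t\<bar> \<le> \<bar>s\<bar> \<and> q (x + s)
      = (\<Sum>m<2. d m (x + 0) / fact m * s ^ m) + d 2 (x + t) / fact 2 * s ^ 2"
  proof (rule Maclaurin_bi_le[where diff = "\<lambda>m s. d m (x + s)" and f = "\<lambda>s. q (x + s)"])
    show "\<forall>m t. m < 2 \<and> \<bar>t\<bar> \<le> \<bar>s\<bar> \<longrightarrow>
      ((\<lambda>s. d m (x + s)) has_field_derivative d (Suc m) (x + t)) (at t)"
    proof (intro allI impI)
      fix m :: nat and t assume "m < 2 \<and> \<bar>t\<bar> \<le> \<bar>s\<bar>"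
      then have "m = 0 \<or> m = 1" by linarith
      then have "(d m has_field_derivative d (Suc m) (x + t)) (at (x + t))"
        using bounded_C2D(1,2)[OF assms] by (auto simp: d_def)
      then show "((\<lambda>s. d m (x + s)) has_field_derivative d (Suc m) (x + t)) (at t)"
        by (simp add: DERIV_shift add.commute)
    qed
  qed (simp add: d_def)
  then show "\<exists>t. \<bar>t\<bar> \<le> \<bar>s\<bar> \<and> q (x + s) = q x + q1 x * s + q2 (x + t) * s\<^sup>2 / 2"
    by (simp add: d_def eval_nat_numeral)
  define e where "e = (\<lambda>m::nat. if m = 0 then q1 else q2)"
  have "\<exists>t. \<bar>t\<bar> \<le> \<bar>s\<bar> \<and> q1 (x + s)
      = (\<Sum>m<1. e m (x + 0) / fact m * s ^ m) + e 1 (x + t) / fact 1 * s ^ 1"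
  proof (rule Maclaurin_bi_le[where diff = "\<lambda>m s. e m (x + s)" and f = "\<lambda>s. q1 (x + s)"])
    show "\<forall>m t. m < 1 \<and> \<bar>t\<bar> \<le> \<bar>s\<bar> \<longrightarrow>
      ((\<lambda>s. e m (x + s)) has_field_derivative e (Suc m) (x + t)) (at t)"
      using bounded_C2D(2)[OF assms] by (auto simp: e_def DERIV_shift[symmetric] add.commute[of x])
  qed (simp add: e_def)
  then show "\<exists>t. \<bar>t\<bar> \<le> \<bar>s\<bar> \<and> q1 (x + s) = q1 x + q2 (x + t) * s"
    by (simp add: e_def)
qed

text \<open>Lagrange remainders in terms of \<open>q2\<close>, combined with its Lipschitz constant
  instead of a third derivative; hence the factor 1/2 rather than 1/6 in the cubic bound.\<close>

lemma bounded_C2_bounds: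
  assumes n: "bounded_C2 K c B q q1 q2"
  shows "\<bar>q (x + s) - q x - q1 x * s\<bar> \<le> K * s\<^sup>2 / 2"
    and "q (x + s) - q x - q1 x * s \<le> c * s\<^sup>2 / 2"
    and "\<bar>q (x + s) - q x - q1 x * s - q2 x * s\<^sup>2 / 2\<bar> \<le> B * \<bar>s\<bar> ^ 3 / 2"
    and "\<bar>q1 (x + s) - q1 x - q2 x * s\<bar> \<le> B * s\<^sup>2"
    and "\<bar>q1 (x + s) - q1 x\<bar> \<le> K * \<bar>s\<bar>"
proof -
  obtain t where t: "\<bar>t\<bar> \<le> \<bar>s\<bar>" "q (x + s) - q x - q1 x * s = q2 (x + t) * s\<^sup>2 / 2"
    using bounded_C2_taylor(1)[OF n, of s x] by auto
  obtain r where r: "\<bar>r\<bar> \<le> \<bar>s\<bar>" "q1 (x + s) - q1 x = q2 (x + r) * s"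
    using bounded_C2_taylor(2)[OF n, of s x] by auto
  have lip: "\<bar>q2 (x + t) - q2 x\<bar> \<le> B * \<bar>s\<bar>" if "\<bar>t\<bar> \<le> \<bar>s\<bar>" for t
    using bounded_C2D(5)[OF n, of "x + t" x] mult_left_mono[OF that bounded_C2D(7)[OF n]] by simp
  show "\<bar>q (x + s) - q x - q1 x * s\<bar> \<le> K * s\<^sup>2 / 2"
    unfolding t using bounded_C2D(3)[OF n, of "x + t"] by (simp add: abs_mult mult_right_mono)
  show "q (x + s) - q x - q1 x * s \<le> c * s\<^sup>2 / 2"
    unfolding t using bounded_C2D(4)[OF n, of "x + t"] by (simp add: mult_right_mono)
  have "q (x + s) - q x - q1 x * s - q2 x * s\<^sup>2 / 2 = (q2 (x + t) - q2 x) * s\<^sup>2 / 2"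
    unfolding t by (simp add: field_simps)
  also have "\<bar>\<dots>\<bar> \<le> B * \<bar>s\<bar> * s\<^sup>2 / 2"
    using lip[OF t(1)] by (simp add: abs_mult mult_right_mono)
  also have "\<dots> = B * \<bar>s\<bar> ^ 3 / 2"
    by (simp add: power3_eq_cube power2_eq_square flip: abs_mult)
  finally show "\<bar>q (x + s) - q x - q1 x * s - q2 x * s\<^sup>2 / 2\<bar> \<le> B * \<bar>s\<bar> ^ 3 / 2" .
  have "q1 (x + s) - q1 x - q2 x * s = (q2 (x + r) - q2 x) * s"
    unfolding r by (simp add: field_simps)
  also have "\<bar>\<dots>\<bar> \<le> B * \<bar>s\<bar> * \<bar>s\<bar>"
    using lip[OF r(1)] by (simp add: abs_mult mult_right_mono)
  finally show "\<bar>q1 (x + s) - q1 x - q2 x * s\<bar> \<le> B * s\<^sup>2"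
    by (simp add: power2_eq_square mult.assoc)
  show "\<bar>q1 (x + s) - q1 x\<bar> \<le> K * \<bar>s\<bar>"
    unfolding r using bounded_C2D(3)[OF n, of "x + r"] by (simp add: abs_mult mult_right_mono)
qed

text \<open>Every polynomial error is measured in the single weight
  \<open>exp \<bar>y\<bar>\<close>, whose Gaussian mean is the only moment constant that occurs
  later.\<close>

lemma abs_poly_le_exp_abs:
  fixes y :: real
  shows "1 \<le> exp \<bar>y\<bar>" "\<bar>y\<bar> \<le> exp \<bar>y\<bar>" "y\<^sup>2 / 2 \<le> exp \<bar>y\<bar>"
    "(y\<^sup>2 + 1) / 2 \<le> exp \<bar>y\<bar>" "\<bar>y\<bar> ^ 3 / 6 \<le> exp \<bar>y\<bar>"
proof -
  have "1 + \<bar>y\<bar> + y\<^sup>2 / 2 \<le> exp \<bar>y\<bar>"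
    using exp_lower_Taylor_quadratic[of "\<bar>y\<bar>"] by simp
  moreover have "0 \<le> y\<^sup>2" "0 \<le> \<bar>y\<bar>" by auto
  ultimately show "1 \<le> exp \<bar>y\<bar>" "\<bar>y\<bar> \<le> exp \<bar>y\<bar>" "y\<^sup>2 / 2 \<le> exp \<bar>y\<bar>"
      "(y\<^sup>2 + 1) / 2 \<le> exp \<bar>y\<bar>"
    unfolding add_divide_distrib by linarith+
  have "(\<Sum>n<4. \<bar>y\<bar> ^ n / fact n) \<le> exp \<bar>y\<bar>"
    unfolding exp_def
    using sum_le_suminf[OF summable_exp_generic[of "\<bar>y\<bar>"], of "{..<4}"]
    by (simp add: divide_inverse mult.commute)
  moreover have "(\<Sum>n<4. \<bar>y\<bar> ^ n / fact n) = 1 + \<bar>y\<bar> + \<bar>y\<bar>\<^sup>2 / 2 + \<bar>y\<bar> ^ 3 / 6"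
    by (simp add: eval_nat_numeral)
  moreover have "0 \<le> y\<^sup>2 / 2" by simp
  ultimately show "\<bar>y\<bar> ^ 3 / 6 \<le> exp \<bar>y\<bar>"
    unfolding power2_abs by linarith
qed

lemma bounded_C2_exp_growth:
  assumes n: "bounded_C2 K c B q q1 q2"
  shows "exp_growth q" "exp_growth q1" "exp_growth q2"
proof -
  have cont: "continuous_on UNIV q" "continuous_on UNIV q1"
    using bounded_C2D(1,2)[OF n]
    by (meson DERIV_isCont continuous_at_imp_continuous_on)+
  have "B-lipschitz_on UNIV q2"
    using bounded_C2D(5,7)[OF n] by (auto simp: lipschitz_on_def dist_real_def)
  then have cont2: "continuous_on UNIV q2"
    by (rule lipschitz_on_continuous_on)
  have "\<bar>q x\<bar> \<le> (\<bar>q 0\<bar> + \<bar>q1 0\<bar> + K) * exp \<bar>x\<bar>" for x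
  proof -
    have "\<bar>q x\<bar> \<le> \<bar>q 0\<bar> + \<bar>q1 0\<bar> * \<bar>x\<bar> + K * (x\<^sup>2 / 2)"
      using bounded_C2_bounds(1)[OF n, of 0 x] unfolding abs_mult[symmetric] add_0 by linarith
    also have "\<dots> \<le> \<bar>q 0\<bar> * exp \<bar>x\<bar> + \<bar>q1 0\<bar> * exp \<bar>x\<bar> + K * exp \<bar>x\<bar>"
      using bounded_C2D(6)[OF n] abs_poly_le_exp_abs(1-3)[of x]
      by (intro add_mono mult_left_mono) (auto simp: mult_le_cancel_left1)
    finally show ?thesis by (simp add: algebra_simps)
  qed
  then show "exp_growth q" using cont by (auto simp: exp_growth_def)
  have "\<bar>q1 x\<bar> \<le> (\<bar>q1 0\<bar> + K) * exp \<bar>x\<bar>" for x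
  proof -
    have "\<bar>q1 x\<bar> \<le> \<bar>q1 0\<bar> + K * \<bar>x\<bar>"
      using bounded_C2_bounds(5)[OF n, of 0 x] by simp
    also have "\<dots> \<le> \<bar>q1 0\<bar> * exp \<bar>x\<bar> + K * exp \<bar>x\<bar>"
      using bounded_C2D(6)[OF n] abs_poly_le_exp_abs(1-3)[of x]
      by (intro add_mono mult_left_mono) (auto simp: mult_le_cancel_left1)
    finally show ?thesis by (simp add: algebra_simps)
  qed
  then show "exp_growth q1" using cont by (auto simp: exp_growth_def)
  have "\<bar>q2 x\<bar> \<le> K * exp \<bar>x\<bar>" for x
    using bounded_C2D(3)[OF n, of x] mult_left_mono[OF abs_poly_le_exp_abs(1)[of x] bounded_C2D(6)[OF n]]
    by simp
  then show "exp_growth q2" using cont2 by (auto simp: exp_growth_def)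
qed

text \<open>A quadratic remainder is a form of differentiability that passes through averages, so
  differentiation under the integral needs no limit theorem.\<close>

lemma has_field_derivative_quadratic:
  fixes F :: "real \<Rightarrow> real"
  assumes "\<And>s. \<bar>F (x + s) - F x - D * s\<bar> \<le> C * s\<^sup>2"
  shows "(F has_field_derivative D) (at x)"
  unfolding has_field_derivative_iff
proof (rule LIM_zero_cancel, rule tendsto_0_le[where K = 1])
  show "((\<lambda>y. C * \<bar>y - x\<bar>) \<longlongrightarrow> 0) (at x)"
    by (auto intro!: tendsto_eq_intros)
  have "\<bar>(F y - F x) / (y - x) - D\<bar> \<le> \<bar>C * \<bar>y - x\<bar>\<bar>" if "y \<noteq> x" for y
  proof -
    have "\<bar>(F y - F x) / (y - x) - D\<bar> = \<bar>F (x + (y - x)) - F x - D * (y - x)\<bar> / \<bar>y - x\<bar>"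
      using that by (simp add: field_simps flip: abs_divide)
    also have "\<dots> \<le> C * (y - x)\<^sup>2 / \<bar>y - x\<bar>"
      by (intro divide_right_mono assms) auto
    also have "\<dots> = C * \<bar>y - x\<bar>"
      using that by (simp add: power2_eq_square field_simps flip: abs_mult)
    finally show ?thesis by linarith
  qed
  then show "\<forall>\<^sub>F y in at x. norm ((F y - F x) / (y - x) - D) \<le> norm (C * \<bar>y - x\<bar>) * 1"
    by (auto simp: eventually_at intro!: exI[of _ 1])
qed

text \<open>The Taylor remainders are uniform in the base point, so they survive averaging over
  translates; this identifies the derivatives of \<open>smooth a q\<close>. The bounds on
  \<open>q2\<close> are averages of pointwise bounds.\<close>

lemma smooth_bounded_C2:
  assumes n: "bounded_C2 K c B q q1 q2"
  shows "bounded_C2 K c B (smooth a q) (smooth a q1) (smooth a q2)"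
proof -
  note g = bounded_C2_exp_growth[OF n]
  note int = exp_growth_integrable[OF g(1)] exp_growth_integrable[OF g(2)] exp_growth_integrable[OF g(3)]
  have taylor: "\<bar>smooth a F (x + s) - smooth a F x - smooth a F1 x * s\<bar> \<le> C * s\<^sup>2"
    if "\<And>x. integrable gauss (\<lambda>y. F (x + a * y))" "\<And>x. integrable gauss (\<lambda>y. F1 (x + a * y))"
      "\<And>x. \<bar>F (x + s) - F x - F1 x * s\<bar> \<le> C * s\<^sup>2" for F F1 C x s
  proof -
    have shift: "x + a * y + s = x + s + a * y" for y by simp
    have shifted: "integrable gauss (\<lambda>y. F (x + a * y + s))"
      unfolding shift by (rule that(1))
    have "\<bar>smooth a F (x + s) - smooth a F x - smooth a F1 x * s\<bar>
        = \<bar>\<integral>y. F (x + a * y + s) - F (x + a * y) - F1 (x + a * y) * s \<partial>gauss\<bar>"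
      using that(1)[of x] shifted that(2)[of x] by (simp add: smooth_def shift)
    also have "\<dots> \<le> (\<integral>y. \<bar>F (x + a * y + s) - F (x + a * y) - F1 (x + a * y) * s\<bar> \<partial>gauss)"
      by (rule integral_abs_bound)
    also have "\<dots> \<le> (\<integral>y. C * s\<^sup>2 \<partial>gauss)"
    proof (rule integral_mono)
      show "integrable gauss (\<lambda>y. \<bar>F (x + a * y + s) - F (x + a * y) - F1 (x + a * y) * s\<bar>)"
        by (rule integrable_abs, rule Bochner_Integration.integrable_diff[OF
              Bochner_Integration.integrable_diff[OF shifted that(1)] integrable_mult_left[OF that(2)]])
      show "\<bar>F (x + a * y + s) - F (x + a * y) - F1 (x + a * y) * s\<bar> \<le> C * s\<^sup>2" for y
        by (rule that(3))
    qed simp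
    finally show ?thesis by simp
  qed
  have d1: "(smooth a q has_field_derivative smooth a q1 x) (at x)" for x
    by (rule has_field_derivative_quadratic[where C = "K / 2"], rule taylor)
       (use bounded_C2_bounds(1)[OF n] in \<open>auto intro: int\<close>)
  have d2: "(smooth a q1 has_field_derivative smooth a q2 x) (at x)" for x
    by (rule has_field_derivative_quadratic[where C = B], rule taylor)
       (use bounded_C2_bounds(4)[OF n] in \<open>auto intro: int\<close>)
  have le: "smooth a q2 x \<le> C" if "\<And>x. q2 x \<le> C" for x C
    unfolding smooth_def using integral_mono[OF int(3), of "\<lambda>_. C" x a] that
    by simp
  have ge: "C \<le> smooth a q2 x" if "\<And>x. C \<le> q2 x" for x C
    unfolding smooth_def using integral_mono[OF _ int(3), of "\<lambda>_. C" x a] that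
    by simp
  have abs: "\<bar>smooth a q2 x\<bar> \<le> K" for x
    using le[of K x] ge[of "- K" x] bounded_C2D(3)[OF n] by (auto simp: abs_le_iff minus_le_iff)
  have lip: "\<bar>smooth a q2 x - smooth a q2 y\<bar> \<le> B * \<bar>x - y\<bar>" for x y
  proof -
    have "\<bar>smooth a q2 x - smooth a q2 y\<bar> = \<bar>\<integral>s. q2 (x + a * s) - q2 (y + a * s) \<partial>gauss\<bar>"
      by (simp add: smooth_def int)
    also have "\<dots> \<le> (\<integral>s. \<bar>q2 (x + a * s) - q2 (y + a * s)\<bar> \<partial>gauss)"
      by (rule integral_abs_bound)
    also have "\<dots> \<le> (\<integral>s. B * \<bar>x - y\<bar> \<partial>gauss)"
    proof (rule integral_mono)
      show "integrable gauss (\<lambda>s. \<bar>q2 (x + a * s) - q2 (y + a * s)\<bar>)"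
        by (intro integrable_abs Bochner_Integration.integrable_diff int)
      show "\<bar>q2 (x + a * s) - q2 (y + a * s)\<bar> \<le> B * \<bar>x - y\<bar>" for s
        using bounded_C2D(5)[OF n, of "x + a * s" "y + a * s"] by simp
    qed simp
    finally show ?thesis by simp
  qed
  show ?thesis
    unfolding bounded_C2_def using d1 d2 abs le[OF bounded_C2D(4)[OF n]] lip by auto
qed

definition gauss_moment :: real where
  "gauss_moment = (\<integral>y. exp \<bar>y\<bar> \<partial>gauss)"

lemma gauss_moment_ge_1: "1 \<le> gauss_moment"
  using integral_mono[of gauss "\<lambda>_. 1" "\<lambda>y. exp \<bar>y\<bar>"] gauss_exp_abs[of 1] gauss.prob_space
  by (simp add: gauss_moment_def)

lemma gauss_average_bound:
  fixes F :: "real \<Rightarrow> real"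
  assumes [measurable]: "F \<in> borel_measurable borel" and F: "\<And>y. \<bar>F y\<bar> \<le> C * exp \<bar>y\<bar>"
  shows "integrable gauss F" "\<bar>integral\<^sup>L gauss F\<bar> \<le> C * gauss_moment"
proof -
  have C: "C \<ge> 0" using F[of 0] by simp
  have e: "integrable gauss (\<lambda>y. C * exp \<bar>y\<bar>)" using gauss_exp_abs[of 1] by simp
  show i: "integrable gauss F"
    by (rule Bochner_Integration.integrable_bound[OF e]) (use C F in auto)
  have "\<bar>integral\<^sup>L gauss F\<bar> \<le> (\<integral>y. \<bar>F y\<bar> \<partial>gauss)" by (rule integral_abs_bound)
  also have "\<dots> \<le> (\<integral>y. C * exp \<bar>y\<bar> \<partial>gauss)"
    using i e F by (intro integral_mono) auto
  finally show "\<bar>integral\<^sup>L gauss F\<bar> \<le> C * gauss_moment" by (simp add: gauss_moment_def)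
qed

text \<open>Taylor expansion at x, integrated with Gaussian mean 0 and variance 1. Subtracting the
  linear term, which has mean zero, improves the error for \<open>q1\<close> from order a to order
  a^2. The last, one-sided bound feeds the crude majorant.\<close>

lemma smooth_expansion:
  assumes n: "bounded_C2 K c B q q1 q2" and a: "0 \<le> a"
  shows "\<bar>smooth a q2 x - q2 x\<bar> \<le> B * a * gauss_moment"
    and "\<bar>smooth a q1 x - q1 x\<bar> \<le> 2 * B * a\<^sup>2 * gauss_moment"
    and "\<bar>smooth a q x - q x - q2 x * a\<^sup>2 / 2\<bar> \<le> 3 * B * a ^ 3 * gauss_moment"
    and "- (K * a\<^sup>2 / 2) \<le> smooth a q x - q x"
proof -
  note g = bounded_C2_exp_growth[OF n]
  note [measurable] = g[THEN exp_growth_measurable]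
  note int = exp_growth_integrable[OF g(1)] exp_growth_integrable[OF g(2)] exp_growth_integrable[OF g(3)]
  have i1: "integrable gauss (\<lambda>y. y)" and i2: "integrable gauss (\<lambda>y. y\<^sup>2)"
    by (rule gauss_average_bound(1)[of _ 1], simp, use abs_poly_le_exp_abs(2) in simp)
       (rule gauss_average_bound(1)[of _ 2], simp, use abs_poly_le_exp_abs(3) in \<open>simp add: mult.commute\<close>)
  have B: "B \<ge> 0" by (rule bounded_C2D(7)[OF n])
  have "smooth a q2 x - q2 x = (\<integral>y. q2 (x + a * y) - q2 x \<partial>gauss)"
    using int(3) by (simp add: smooth_def)
  also have "\<bar>\<dots>\<bar> \<le> B * a * gauss_moment"
  proof (rule gauss_average_bound(2))
    fix y
    have "\<bar>q2 (x + a * y) - q2 x\<bar> \<le> B * a * \<bar>y\<bar>"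
      using bounded_C2D(5)[OF n, of "x + a * y" x] a by (simp add: abs_mult mult.assoc)
    also have "\<dots> \<le> B * a * exp \<bar>y\<bar>"
      using B a by (intro mult_left_mono abs_poly_le_exp_abs) auto
    finally show "\<bar>q2 (x + a * y) - q2 x\<bar> \<le> B * a * exp \<bar>y\<bar>" .
  qed simp
  finally show "\<bar>smooth a q2 x - q2 x\<bar> \<le> B * a * gauss_moment" .
  have "smooth a q1 x - q1 x = (\<integral>y. q1 (x + a * y) - q1 x - q2 x * (a * y) \<partial>gauss)"
    using int(2) i1 gauss_mean by (simp add: smooth_def)
  also have "\<bar>\<dots>\<bar> \<le> 2 * B * a\<^sup>2 * gauss_moment"
  proof (rule gauss_average_bound(2))
    fix y
    have "\<bar>q1 (x + a * y) - q1 x - q2 x * (a * y)\<bar> \<le> 2 * B * a\<^sup>2 * (y\<^sup>2 / 2)"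
      using bounded_C2_bounds(4)[OF n, of x "a * y"] by (simp add: power_mult_distrib mult.assoc)
    also have "\<dots> \<le> 2 * B * a\<^sup>2 * exp \<bar>y\<bar>"
      using B by (intro mult_left_mono abs_poly_le_exp_abs) auto
    finally show "\<bar>q1 (x + a * y) - q1 x - q2 x * (a * y)\<bar> \<le> 2 * B * a\<^sup>2 * exp \<bar>y\<bar>" .
  qed simp
  finally show "\<bar>smooth a q1 x - q1 x\<bar> \<le> 2 * B * a\<^sup>2 * gauss_moment" .
  have "smooth a q x - q x - q2 x * a\<^sup>2 / 2
      = (\<integral>y. q (x + a * y) - q x - q1 x * (a * y) - q2 x * (a * y)\<^sup>2 / 2 \<partial>gauss)"
    using int(1) i1 i2 gauss_mean gauss_second_moment
    by (simp add: smooth_def power_mult_distrib)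
  also have "\<bar>\<dots>\<bar> \<le> 3 * B * a ^ 3 * gauss_moment"
  proof (rule gauss_average_bound(2))
    fix y
    have "\<bar>q (x + a * y) - q x - q1 x * (a * y) - q2 x * (a * y)\<^sup>2 / 2\<bar> \<le> 3 * B * a ^ 3 * (\<bar>y\<bar> ^ 3 / 6)"
      using bounded_C2_bounds(3)[OF n, of x "a * y"] a by (simp add: power_mult_distrib abs_mult mult.assoc)
    also have "\<dots> \<le> 3 * B * a ^ 3 * exp \<bar>y\<bar>"
      using B a by (intro mult_left_mono abs_poly_le_exp_abs) auto
    finally show "\<bar>q (x + a * y) - q x - q1 x * (a * y) - q2 x * (a * y)\<^sup>2 / 2\<bar> \<le> 3 * B * a ^ 3 * exp \<bar>y\<bar>" .
  qed simp
  finally show "\<bar>smooth a q x - q x - q2 x * a\<^sup>2 / 2\<bar> \<le> 3 * B * a ^ 3 * gauss_moment" .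
  have "- (K * a\<^sup>2 / 2) = (\<integral>y. - (K * a\<^sup>2 / 2) * y\<^sup>2 \<partial>gauss)"
    using i2 gauss_second_moment by simp
  also have "\<dots> \<le> (\<integral>y. q (x + a * y) - q x - q1 x * (a * y) \<partial>gauss)"
  proof (rule integral_mono)
    fix y
    show "- (K * a\<^sup>2 / 2) * y\<^sup>2 \<le> q (x + a * y) - q x - q1 x * (a * y)"
      using bounded_C2_bounds(1)[OF n, of x "a * y"]
      unfolding abs_le_iff power_mult_distrib by (simp add: algebra_simps)
  qed (use i2 i1 int(1) in auto)
  also have "\<dots> = smooth a q x - q x"
    using int(1) i1 gauss_mean by (simp add: smooth_def)
  finally show "- (K * a\<^sup>2 / 2) \<le> smooth a q x - q x" .
qed

text \<open>The first bound is sharp in a, but its weight \<open>exp \<bar>y\<bar>\<close> cannot be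
  exponentiated. The second loses the precise main term and keeps exactly c y^2 / 2 plus linear
  growth in |y|, so its exponential is integrable for c < 1.\<close>

lemma increment_expansion:
  assumes n: "bounded_C2 K c B q q1 q2" and a: "0 \<le> a"
  shows "\<bar>q (x + a * y) - smooth a q x - smooth a q1 x * (a * y) - a\<^sup>2 * (smooth a q2 x * (y\<^sup>2 - 1) / 2)\<bar>
      \<le> 9 * B * gauss_moment * a ^ 3 * exp \<bar>y\<bar>" (is "\<bar>?D - _\<bar> \<le> _")
    and "q (x + a * y) - smooth a q x - smooth a q1 x * (a * y)
      \<le> a\<^sup>2 * (c * y\<^sup>2 / 2 + K / 2 + 2 * B * gauss_moment * a * \<bar>y\<bar>)"
proof -
  let ?m = "gauss_moment" and ?e = "exp \<bar>y\<bar>"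
  have B: "B \<ge> 0" by (rule bounded_C2D(7)[OF n])
  note m = gauss_moment_ge_1
  have mul: "u * v \<le> w * z" if "u \<le> w" "v \<le> z" "0 \<le> w" "0 \<le> v" for u v w z :: real
    using that by (intro mult_mono) auto
  have e1: "1 \<le> ?e" by (rule abs_poly_le_exp_abs)
  have Bm: "0 \<le> B * a ^ 3" "0 \<le> B * a ^ 3 * ?m" using B a m by auto
  have t1: "\<bar>q (x + a * y) - q x - q1 x * (a * y) - q2 x * (a * y)\<^sup>2 / 2\<bar> \<le> 3 * (B * a ^ 3 * ?m * ?e)"
  proof -
    have "\<bar>q (x + a * y) - q x - q1 x * (a * y) - q2 x * (a * y)\<^sup>2 / 2\<bar> \<le> 3 * (B * a ^ 3 * 1 * (\<bar>y\<bar> ^ 3 / 6))"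
      using bounded_C2_bounds(3)[OF n, of x "a * y"] a by (simp add: power_mult_distrib abs_mult mult.assoc)
    also have "\<dots> \<le> 3 * (B * a ^ 3 * ?m * ?e)"
      using m Bm abs_poly_le_exp_abs(5)[of y] by (intro mult_left_mono mul) auto
    finally show ?thesis .
  qed
  have t2: "\<bar>smooth a q x - q x - q2 x * a\<^sup>2 / 2\<bar> \<le> 3 * (B * a ^ 3 * ?m * ?e)"
  proof -
    have "\<bar>smooth a q x - q x - q2 x * a\<^sup>2 / 2\<bar> \<le> 3 * (B * a ^ 3 * ?m * 1)"
      using smooth_expansion(3)[OF n a, of x] by (simp add: mult.assoc)
    also have "\<dots> \<le> 3 * (B * a ^ 3 * ?m * ?e)"
      using Bm e1 by (intro mult_left_mono) auto
    finally show ?thesis .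
  qed
  have t3: "\<bar>(smooth a q1 x - q1 x) * (a * y)\<bar> \<le> 2 * (B * a ^ 3 * ?m * ?e)"
  proof -
    have "\<bar>(smooth a q1 x - q1 x) * (a * y)\<bar> \<le> (2 * B * a\<^sup>2 * ?m) * (a * ?e)"
      unfolding abs_mult using smooth_expansion(2)[OF n a, of x] a B m abs_poly_le_exp_abs(2)[of y]
      by (intro mul mult_nonneg_nonneg) auto
    then show ?thesis by (simp add: power3_eq_cube power2_eq_square mult_ac)
  qed
  have t4: "\<bar>(smooth a q2 x - q2 x) * (a\<^sup>2 * ((y\<^sup>2 - 1) / 2))\<bar> \<le> B * a ^ 3 * ?m * ?e"
  proof -
    have "\<bar>(y\<^sup>2 - 1) / 2\<bar> \<le> (y\<^sup>2 + 1) / 2" by (simp add: abs_le_iff)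
    also have "\<dots> \<le> ?e" by (rule abs_poly_le_exp_abs)
    finally have "\<bar>(smooth a q2 x - q2 x) * (a\<^sup>2 * ((y\<^sup>2 - 1) / 2))\<bar> \<le> (B * a * ?m) * (a\<^sup>2 * ?e)"
      unfolding abs_mult using smooth_expansion(1)[OF n a, of x] a B m
      by (intro mul mult_nonneg_nonneg mult_left_mono) auto
    then show ?thesis by (simp add: power3_eq_cube power2_eq_square mult_ac)
  qed
  \<comment> \<open>Replacing the derivatives at x by their averages produces four errors, bounded
    in \<open>t1\<close> to \<open>t4\<close> with coefficients 3 + 3 + 2 + 1 = 9.\<close>
  have split: "?D - a\<^sup>2 * (smooth a q2 x * (y\<^sup>2 - 1) / 2)
     = (q (x + a * y) - q x - q1 x * (a * y) - q2 x * (a * y)\<^sup>2 / 2)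
       - (smooth a q x - q x - q2 x * a\<^sup>2 / 2)
       - (smooth a q1 x - q1 x) * (a * y) - (smooth a q2 x - q2 x) * (a\<^sup>2 * ((y\<^sup>2 - 1) / 2))"
    by (simp add: field_simps power_mult_distrib)
  have "\<bar>?D - a\<^sup>2 * (smooth a q2 x * (y\<^sup>2 - 1) / 2)\<bar> \<le> 9 * (B * a ^ 3 * ?m * ?e)"
    unfolding split using t1 t2 t3 t4 by linarith
  then show "\<bar>?D - a\<^sup>2 * (smooth a q2 x * (y\<^sup>2 - 1) / 2)\<bar> \<le> 9 * B * ?m * a ^ 3 * ?e"
    by (simp add: mult_ac)
  have "- ((smooth a q1 x - q1 x) * (a * y)) \<le> (2 * B * a\<^sup>2 * ?m) * (a * \<bar>y\<bar>)"
  proof -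
    have "\<bar>(smooth a q1 x - q1 x) * (a * y)\<bar> \<le> (2 * B * a\<^sup>2 * ?m) * (a * \<bar>y\<bar>)"
      unfolding abs_mult using smooth_expansion(2)[OF n a, of x] a B m
      by (intro mul mult_nonneg_nonneg) auto
    then show ?thesis by linarith
  qed
  moreover have "?D = (q (x + a * y) - q x - q1 x * (a * y)) - (smooth a q x - q x)
      - (smooth a q1 x - q1 x) * (a * y)"
    by (simp add: algebra_simps)
  moreover have "q (x + a * y) - q x - q1 x * (a * y) \<le> c * (a * y)\<^sup>2 / 2"
    by (rule bounded_C2_bounds(2)[OF n])
  ultimately have "?D \<le> c * (a * y)\<^sup>2 / 2 + K * a\<^sup>2 / 2 + (2 * B * a\<^sup>2 * ?m) * (a * \<bar>y\<bar>)"
    using smooth_expansion(4)[OF n a, of x] by linarith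
  also have "\<dots> = a\<^sup>2 * (c * y\<^sup>2 / 2 + K / 2 + 2 * B * ?m * a * \<bar>y\<bar>)"
    by (simp add: field_simps power_mult_distrib)
  finally show "?D \<le> a\<^sup>2 * (c * y\<^sup>2 / 2 + K / 2 + 2 * B * ?m * a * \<bar>y\<bar>)" .
qed

section \<open>One-step exponential moments\<close>

lemma \<Psi>_nonneg: "z < 1 \<Longrightarrow> 0 \<le> \<Psi> z"
  using ln_le_minus_one[of "1 - z"] by (simp add: \<Psi>_def)

text \<open>The derivative of \<open>\<Psi>\<close> is (-1 + 1 / (1 - z)) / 2, which stays bounded
  below any level c < 1. The proof only uses ln t <= t - 1.\<close>

lemma \<Psi>_lipschitz:
  assumes "c < 1" "z \<le> c" "w \<le> c"
  shows "\<bar>\<Psi> z - \<Psi> w\<bar> \<le> (1 + 1 / (1 - c)) / 2 * \<bar>z - w\<bar>"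
proof -
  have *: "ln (1 - z) - ln (1 - w) \<le> \<bar>z - w\<bar> / (1 - c)" if "z \<le> c" "w \<le> c" for z w
  proof -
    have "ln (1 - z) - ln (1 - w) = ln ((1 - z) / (1 - w))"
      using that assms(1) by (simp add: ln_div)
    also have "\<dots> \<le> (1 - z) / (1 - w) - 1"
      using that assms(1) by (intro ln_le_minus_one) auto
    also have "\<dots> = (w - z) / (1 - w)"
      using that assms(1) by (simp add: field_simps)
    also have "\<dots> \<le> \<bar>z - w\<bar> / (1 - c)"
      using that assms(1) by (intro frac_le) auto
    finally show ?thesis .
  qed
  define t where "t = \<bar>z - w\<bar> / (1 - c)"
  have "\<bar>ln (1 - z) - ln (1 - w)\<bar> \<le> t"
    using *[OF assms(2,3)] *[OF assms(3,2)] by (simp add: t_def abs_le_iff abs_minus_commute)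
  then have "\<bar>\<Psi> z - \<Psi> w\<bar> \<le> (\<bar>z - w\<bar> + t) / 2"
    using abs_triangle_ineq[of "w - z" "ln (1 - w) - ln (1 - z)"]
    by (simp add: \<Psi>_def abs_minus_commute flip: diff_divide_distrib)
  then show ?thesis by (simp add: t_def algebra_simps)
qed

text \<open>One-dimensional Cameron-Martin formula: translate Lebesgue measure by b and divide the
  two Gaussian densities.\<close>

lemma
  fixes F :: "real \<Rightarrow> real"
  assumes [measurable]: "F \<in> borel_measurable borel"
  shows gauss_shift: "integral\<^sup>L gauss F = (\<integral>y. F (y + b) * exp (- (b * y) - b\<^sup>2 / 2) \<partial>gauss)"
    and gauss_shift_integrable:
      "integrable gauss F \<Longrightarrow> integrable gauss (\<lambda>y. F (y + b) * exp (- (b * y) - b\<^sup>2 / 2))"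
proof -
  have eq: "std_normal_density (b + y) * F (b + y)
      = std_normal_density y * (F (y + b) * exp (- (b * y) - b\<^sup>2 / 2))" for y
  proof -
    have "exp (- (b + y)\<^sup>2 / 2) = exp (- y\<^sup>2 / 2) * exp (- (b * y) - b\<^sup>2 / 2)"
      unfolding mult_exp_exp by (simp add: power2_sum field_simps)
    then show ?thesis by (simp add: std_normal_density_def add.commute)
  qed
  show "integral\<^sup>L gauss F = (\<integral>y. F (y + b) * exp (- (b * y) - b\<^sup>2 / 2) \<partial>gauss)"
    using lborel_integral_real_affine[of 1 "\<lambda>y. std_normal_density y * F y" b]
    by (simp add: integral_gauss eq)
  show "integrable gauss (\<lambda>y. F (y + b) * exp (- (b * y) - b\<^sup>2 / 2))" if "integrable gauss F"
    using lborel_integrable_real_affine[of "\<lambda>y. std_normal_density y * F y" 1 b] that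
    by (simp add: integrable_gauss eq)
qed

lemma
  fixes F :: "real \<Rightarrow> real"
  assumes [measurable]: "F \<in> borel_measurable borel"
  shows gauss_reflect: "(\<integral>y. F (- y) \<partial>gauss) = integral\<^sup>L gauss F"
    and gauss_reflect_integrable: "integrable gauss F \<Longrightarrow> integrable gauss (\<lambda>y. F (- y))"
proof -
  have eq: "std_normal_density (- y) * F (- y) = std_normal_density y * F (- y)" for y
    by (simp add: std_normal_density_def)
  show "(\<integral>y. F (- y) \<partial>gauss) = integral\<^sup>L gauss F"
    using lborel_integral_real_affine[of "-1" "\<lambda>y. std_normal_density y * F y" 0]
    by (simp add: integral_gauss eq)
  show "integrable gauss (\<lambda>y. F (- y))" if "integrable gauss F"
    using lborel_integrable_real_affine[of "\<lambda>y. std_normal_density y * F y" "-1" 0] that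
    by (simp add: integrable_gauss eq)
qed

text \<open>With \<open>a = n\<^sup>-\<^sup>1\<^sup>/\<^sup>2\<close> and \<open>q = u (t + 1/n)\<close>, this is the contribution to \<open>n S\<^sub>n\<close> of the step
  from \<open>W\<^sub>t = x\<close> to \<open>x + a y\<close>.\<close>

definition increment_exponent ::
  "real \<Rightarrow> (real \<Rightarrow> real) \<Rightarrow> (real \<Rightarrow> real) \<Rightarrow> real \<Rightarrow> real \<Rightarrow> real" where
  "increment_exponent a q q1 x y = (q (x + a * y) - smooth a q x - smooth a q1 x * (a * y)) / a\<^sup>2"

lemma increment_exponent_bounds:
  assumes n: "bounded_C2 K c B q q1 q2" and a: "0 < a" "a \<le> 1"
  shows "\<bar>increment_exponent a q q1 x y - smooth a q2 x * (y\<^sup>2 - 1) / 2\<bar>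
      \<le> 9 * B * gauss_moment * a * exp \<bar>y\<bar>"
    and "increment_exponent a q q1 x y \<le> c * y\<^sup>2 / 2 + K / 2 + 9 * B * gauss_moment * \<bar>y\<bar>"
    and "smooth a q2 x * (y\<^sup>2 - 1) / 2 \<le> c * y\<^sup>2 / 2 + K / 2"
proof -
  have a2: "a\<^sup>2 > 0" using a by simp
  let ?D = "q (x + a * y) - smooth a q x - smooth a q1 x * (a * y)"
  have "\<bar>increment_exponent a q q1 x y - smooth a q2 x * (y\<^sup>2 - 1) / 2\<bar>
      = \<bar>?D - a\<^sup>2 * (smooth a q2 x * (y\<^sup>2 - 1) / 2)\<bar> / a\<^sup>2"
  proof -
    have "increment_exponent a q q1 x y - smooth a q2 x * (y\<^sup>2 - 1) / 2
        = (?D - a\<^sup>2 * (smooth a q2 x * (y\<^sup>2 - 1) / 2)) / a\<^sup>2"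
      using a by (simp add: increment_exponent_def diff_divide_distrib)
    then show ?thesis using a2 by (simp only: abs_divide abs_power2)
  qed
  also have "\<dots> \<le> (9 * B * gauss_moment * a ^ 3 * exp \<bar>y\<bar>) / a\<^sup>2"
    using increment_expansion(1)[OF n, of a x y] a by (intro divide_right_mono) auto
  also have "\<dots> = 9 * B * gauss_moment * a * exp \<bar>y\<bar>"
    using a by (simp add: power3_eq_cube power2_eq_square)
  finally show "\<bar>increment_exponent a q q1 x y - smooth a q2 x * (y\<^sup>2 - 1) / 2\<bar>
      \<le> 9 * B * gauss_moment * a * exp \<bar>y\<bar>" .
  have "increment_exponent a q q1 x y
      \<le> (a\<^sup>2 * (c * y\<^sup>2 / 2 + K / 2 + 2 * B * gauss_moment * a * \<bar>y\<bar>)) / a\<^sup>2"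
    unfolding increment_exponent_def
    using increment_expansion(2)[OF n, of a x y] a by (intro divide_right_mono) auto
  also have "\<dots> = c * y\<^sup>2 / 2 + K / 2 + 2 * B * gauss_moment * \<bar>y\<bar> * a"
    using a2 by simp
  \<comment> \<open>The coefficient 2 is enlarged to 9 so that one constant serves both the sharp
    bound and the majorant.\<close>
  also have "\<dots> \<le> c * y\<^sup>2 / 2 + K / 2 + 9 * B * gauss_moment * \<bar>y\<bar> * 1"
    using a gauss_moment_ge_1 bounded_C2D(7)[OF n]
    by (intro add_left_mono mult_mono mult_nonneg_nonneg) auto
  finally show "increment_exponent a q q1 x y \<le> c * y\<^sup>2 / 2 + K / 2 + 9 * B * gauss_moment * \<bar>y\<bar>"
    by simp
  note n' = smooth_bounded_C2[OF n, of a]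
  have "smooth a q2 x * y\<^sup>2 \<le> c * y\<^sup>2"
    using bounded_C2D(4)[OF n', of x] by (rule mult_right_mono) auto
  then show "smooth a q2 x * (y\<^sup>2 - 1) / 2 \<le> c * y\<^sup>2 / 2 + K / 2"
    using bounded_C2D(3)[OF n', of x] by (simp add: algebra_simps abs_le_iff)
qed

lemma increment_exponent_measurable:
  assumes n: "bounded_C2 K c B q q1 q2"
  shows "(\<lambda>p. increment_exponent a q q1 (fst p) (snd p)) \<in> borel_measurable (borel \<Otimes>\<^sub>M borel)"
proof -
  have [measurable]: "q \<in> borel_measurable borel" "smooth a q \<in> borel_measurable borel"
      "smooth a q1 \<in> borel_measurable borel"
    using bounded_C2_exp_growth[OF n] bounded_C2_exp_growth[OF smooth_bounded_C2[OF n]]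
    by (auto intro: exp_growth_measurable)
  show ?thesis unfolding increment_exponent_def by measurable
qed

lemma increment_exponent_measurable':
  assumes n: "bounded_C2 K c B q q1 q2"
  shows "increment_exponent a q q1 x \<in> borel_measurable borel"
  using measurable_compose[OF measurable_Pair1'[of x borel borel] increment_exponent_measurable[OF n, of a]]
  by simp

text \<open>Convexity with the tangent taken at u: the difference u - v enters linearly and is
  weighted by exp u, which has a Gaussian majorant in the application.\<close>

lemma exp_le_tangent: "exp u \<le> exp v + \<bar>u - v\<bar> * exp u" for u v :: real
proof -
  have "exp u * (1 + (v - u)) \<le> exp u * exp (v - u)"
    by (intro mult_left_mono exp_ge_add_one_self) auto
  then have "exp u \<le> exp v + (u - v) * exp u"
    unfolding mult_exp_exp by (simp add: algebra_simps)
  also have "\<dots> \<le> exp v + \<bar>u - v\<bar> * exp u"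
    by (intro add_left_mono mult_right_mono) auto
  finally show ?thesis .
qed

text \<open>The constant is chosen before the function, the scale and the point, so it is the same
  for all steps and all n.\<close>

lemma one_step_upper:
  assumes c: "c < 1"
  shows "\<exists>C. \<forall>q q1 q2 a x. bounded_C2 K c B q q1 q2 \<longrightarrow> 0 < a \<longrightarrow> a \<le> 1 \<longrightarrow>
    integrable gauss (\<lambda>y. exp (increment_exponent a q q1 x y)) \<and>
    (\<integral>y. exp (increment_exponent a q q1 x y) \<partial>gauss) \<le> exp (\<Psi> (smooth a q2 x) + C * a)"
proof -
  define R where "R = 9 * B * gauss_moment"
  \<comment> \<open>\<open>J\<close> is the majorant of the integrand, up to
    \<open>exp (K / 2)\<close>, times the error weight \<open>exp \<bar>y\<bar>\<close>, which
    accounts for the 1 in 1 + R.\<close>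
  define J where "J = (\<lambda>y. exp ((1 + R) * \<bar>y\<bar> + c * y\<^sup>2 / 2))"
  have J: "integrable gauss J" unfolding J_def by (rule gauss_exp_quadratic[OF c])
  have IJ: "0 \<le> integral\<^sup>L gauss J" by (simp add: J_def)
  define C where "C = R * exp (K / 2) * integral\<^sup>L gauss J"
  have "integrable gauss (\<lambda>y. exp (increment_exponent a q q1 x y)) \<and>
    (\<integral>y. exp (increment_exponent a q q1 x y) \<partial>gauss) \<le> exp (\<Psi> (smooth a q2 x) + C * a)"
    if n: "bounded_C2 K c B q q1 q2" and a: "0 < a" "a \<le> 1" for q q1 q2 a x
  proof -
    define z where "z = smooth a q2 x"
    have z: "z < 1" using bounded_C2D(4)[OF smooth_bounded_C2[OF n], of a x] c by (simp add: z_def)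
    have R0: "R \<ge> 0" using bounded_C2D(7)[OF n] gauss_moment_ge_1 by (simp add: R_def)
    note b = increment_exponent_bounds[OF n a, of x, folded R_def z_def]
    note [measurable] = increment_exponent_measurable'[OF n, of a x]
    let ?E = "increment_exponent a q q1 x"
    have EJ: "exp (?E y) \<le> exp (K / 2) * exp (R * \<bar>y\<bar> + c * y\<^sup>2 / 2)" for y
      unfolding mult_exp_exp using b(2)[of y] by simp
    have i: "integrable gauss (\<lambda>y. exp (?E y))"
      by (rule Bochner_Integration.integrable_bound[OF
            integrable_mult_right[OF gauss_exp_quadratic[OF c, of R], of "exp (K / 2)"]])
         (use EJ in auto)
    have pt: "exp (?E y) \<le> exp (z * (y\<^sup>2 - 1) / 2) + a * R * exp (K / 2) * J y" for y
    proof -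
      have "\<bar>?E y - z * (y\<^sup>2 - 1) / 2\<bar> * exp (?E y)
          \<le> (R * a * exp \<bar>y\<bar>) * (exp (K / 2) * exp (R * \<bar>y\<bar> + c * y\<^sup>2 / 2))"
        using b(1)[of y] EJ[of y] R0 a by (intro mult_mono) auto
      also have "\<dots> = a * R * exp (K / 2) * (exp \<bar>y\<bar> * exp (R * \<bar>y\<bar> + c * y\<^sup>2 / 2))"
        by (simp add: mult_ac)
      also have "exp \<bar>y\<bar> * exp (R * \<bar>y\<bar> + c * y\<^sup>2 / 2) = J y"
        unfolding mult_exp_exp J_def by (simp add: algebra_simps)
      finally show ?thesis using exp_le_tangent[of "?E y" "z * (y\<^sup>2 - 1) / 2"] by linarith
    qed
    have "(\<integral>y. exp (?E y) \<partial>gauss) \<le> (\<integral>y. exp (z * (y\<^sup>2 - 1) / 2) + a * R * exp (K / 2) * J y \<partial>gauss)"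
      by (rule integral_mono[OF i]) (use pt J gauss_quadratic_mgf(1)[OF z] in auto)
    also have "\<dots> = exp (\<Psi> z) + C * a"
      using J gauss_quadratic_mgf[OF z] by (simp add: C_def)
    \<comment> \<open>Nonnegativity of \<open>\<Psi>\<close> turns the additive error into a
      multiplicative one.\<close>
    also have "\<dots> \<le> exp (\<Psi> z) * (1 + C * a)"
    proof -
      have "0 \<le> C * a" using R0 IJ a by (simp add: C_def)
      then have "1 * (C * a) \<le> exp (\<Psi> z) * (C * a)"
        using \<Psi>_nonneg[OF z] by (intro mult_right_mono) auto
      then show ?thesis by (simp add: algebra_simps)
    qed
    also have "\<dots> \<le> exp (\<Psi> z) * exp (C * a)"
      by (intro mult_left_mono exp_ge_add_one_self) auto
    finally show ?thesis using i by (simp add: z_def exp_add)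
  qed
  then show ?thesis by blast
qed

text \<open>An explicit substitute for the principal eigenfunction of the walk killed outside the
  tube. The indicator of the tube would not do: from a point near the edge about half of the mass
  leaves in one step, a loss by a constant factor.\<close>

definition tent :: "real \<Rightarrow> real \<Rightarrow> real" where
  "tent d r = max 0 (1 - \<bar>r\<bar> / d)"

lemma tent_bounds: "0 \<le> tent d r" "d > 0 \<Longrightarrow> tent d r \<le> 1"
  by (auto simp: tent_def)

lemma tent_zero: "d > 0 \<Longrightarrow> d \<le> \<bar>r\<bar> \<Longrightarrow> tent d r = 0"
  by (simp add: tent_def field_simps)

lemma tent_0 [simp]: "tent d 0 = 1"
  by (simp add: tent_def)

lemma tent_measurable [measurable]: "tent d \<in> borel_measurable borel"
  unfolding tent_def by measurable

text \<open>Averaging over a symmetric displacement costs the tent only a small factor, even near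
  the edge of its support where its values are tiny.\<close>

lemma tent_symmetric_average:
  assumes d: "d > 0"
  shows "tent d r * (1 - 2 * \<bar>s\<bar> / d) \<le> (tent d (r + s) + tent d (r - s)) / 2"
proof (cases "d \<le> \<bar>r\<bar>")
  case True
  then show ?thesis using d tent_bounds[of d "r + s"] tent_bounds[of d "r - s"] by (simp add: tent_zero)
next
  case False
  then have tr: "tent d r = 1 - \<bar>r\<bar> / d" "tent d r > 0" using d by (auto simp: tent_def field_simps)
  \<comment> \<open>In the first case the peak is not crossed, so 1 - |.|/d is affine between the
    two points and the cut at 0 only helps. In the second the peak costs at most |s|/d, while the
    tent at r is at least 1/2, so a relative loss of 2|s|/d covers it. In the third the left side is
    not positive.\<close>
  consider "\<bar>s\<bar> \<le> \<bar>r\<bar>" | "\<bar>r\<bar> < \<bar>s\<bar>" "2 * \<bar>s\<bar> < d" | "2 * \<bar>s\<bar> \<ge> d" by linarith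
  then show ?thesis
  proof cases
    case 1
    have "\<bar>r + s\<bar> + \<bar>r - s\<bar> = 2 * \<bar>r\<bar>" using 1 by linarith
    then have "\<bar>r + s\<bar> / d + \<bar>r - s\<bar> / d = 2 * (\<bar>r\<bar> / d)"
      by (simp flip: add_divide_distrib)
    then have "tent d r \<le> (tent d (r + s) + tent d (r - s)) / 2"
      unfolding tr(1) by (simp add: tent_def)
    moreover have "tent d r * (1 - 2 * \<bar>s\<bar> / d) \<le> tent d r * 1"
      using tr(2) d by (intro mult_left_mono) auto
    ultimately show ?thesis by linarith
  next
    case 2
    have "tent d (r + s) \<ge> 1 - \<bar>r\<bar> / d - \<bar>s\<bar> / d" "tent d (r - s) \<ge> 1 - \<bar>r\<bar> / d - \<bar>s\<bar> / d"
    proof -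
      have "\<bar>r + s\<bar> / d \<le> (\<bar>r\<bar> + \<bar>s\<bar>) / d" "\<bar>r - s\<bar> / d \<le> (\<bar>r\<bar> + \<bar>s\<bar>) / d"
        using d by (auto intro!: divide_right_mono)
      then show "tent d (r + s) \<ge> 1 - \<bar>r\<bar> / d - \<bar>s\<bar> / d" "tent d (r - s) \<ge> 1 - \<bar>r\<bar> / d - \<bar>s\<bar> / d"
        unfolding tent_def add_divide_distrib by linarith+
    qed
    moreover have "tent d r * (1 - 2 * \<bar>s\<bar> / d) \<le> 1 - \<bar>r\<bar> / d - \<bar>s\<bar> / d"
    proof -
      have "\<bar>r\<bar> / d \<le> 1 / 2" using 2 d by (simp add: field_simps)
      then have "(\<bar>s\<bar> / d) * (\<bar>r\<bar> / d) \<le> (\<bar>s\<bar> / d) * (1 / 2)"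
        using d by (intro mult_left_mono) auto
      moreover have "(1 - p) * (1 - 2 * v) \<le> 1 - p - v" if "v * p \<le> v * (1 / 2)" for p v :: real
        using that by (simp add: algebra_simps)
      ultimately show ?thesis unfolding tr(1) times_divide_eq_right[symmetric] by blast
    qed
    moreover have "w \<le> (u + v) / 2" if "e \<le> u" "e \<le> v" "w \<le> e" for e u v w :: real
      using that by simp
    ultimately show ?thesis by blast
  next
    case 3
    then have "tent d r * (1 - 2 * \<bar>s\<bar> / d) \<le> 0"
      using tr(2) d by (simp add: mult_le_0_iff field_simps)
    also have "0 \<le> (tent d (r + s) + tent d (r - s)) / 2"
      by (simp add: tent_bounds)
    finally show ?thesis .
  qed
qed

lemma one_minus_ge_exp:
  fixes t :: real
  assumes "0 \<le> t" "t \<le> 1 / 2"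
  shows "exp (- 2 * t) \<le> 1 - t"
proof -
  have "exp (- 2 * t) = 1 / exp (2 * t)" by (simp add: exp_minus inverse_eq_divide)
  also have "\<dots> \<le> 1 / (1 + 2 * t)"
    using assms exp_ge_add_one_self[of "2 * t"] by (intro divide_left_mono) auto
  also have "\<dots> \<le> 1 - t"
  proof -
    have "t * (2 * t) \<le> t * 1" using assms by (intro mult_left_mono) auto
    then show ?thesis using assms by (simp add: field_simps)
  qed
  finally show ?thesis .
qed

text \<open>The displacement \<open>b\<close> of the tube is absorbed by a Cameron--Martin shift of \<open>y\<close>, after which the
  exponent dominates an even function of \<open>y\<close>; this rules out a drift that would push mass out of the tube.\<close>

lemma one_step_lower:
  assumes c: "c < 1" and d: "d > 0" and \<beta>: "\<beta> \<ge> 0"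
  shows "\<exists>C \<ge> 0. \<forall>q q1 q2 a x r b. bounded_C2 K c B q q1 q2 \<longrightarrow> 0 < a \<longrightarrow> a \<le> 1 \<longrightarrow> C * a \<le> 1 \<longrightarrow>
    \<bar>b\<bar> \<le> \<beta> * a \<longrightarrow>
    tent d r * exp (\<Psi> (smooth a q2 x) - C * a)
      \<le> (\<integral>y. exp (increment_exponent a q q1 x y) * tent d (r + a * (y - b)) \<partial>gauss)"
proof -
  \<comment> \<open>The absolute value makes \<open>R\<close> nonnegative before any function in the
    class is given, since \<open>C \<ge> 0\<close> is claimed outside the quantifiers.\<close>
  define R where "R = 9 * \<bar>B\<bar> * gauss_moment"
  \<comment> \<open>The first term is the expansion error after the shift, via exp |y + b| <= exp
    \<beta> exp |y|. The second bounds (1 - z)(b y + b^2 / 2), which is what remains of the shift in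
    the exponent.\<close>
  define R' where "R' = R * exp \<beta> + (1 + \<bar>K\<bar>) * (\<beta> + \<beta>\<^sup>2)"
  define J where "J = (\<lambda>y. exp (\<bar>y\<bar> + c * y\<^sup>2 / 2))"
  have J: "integrable gauss J" unfolding J_def using gauss_exp_quadratic[OF c, of 1] by simp
  have IJ: "0 \<le> integral\<^sup>L gauss J" by (simp add: J_def)
  \<comment> \<open>\<open>R'\<close> pays for the exponent and 2/d for averaging the tent over the
    displacement a y. The factor 2 in \<open>C\<close> comes from \<open>one_minus_ge_exp\<close>,
    whose condition t <= 1/2 is then exactly C a <= 1.\<close>
  define T where "T = (R' + 2 / d) * exp (K / 2)"
  define C where "C = 2 * T * integral\<^sup>L gauss J"
  have R0: "R \<ge> 0" using gauss_moment_ge_1 by (simp add: R_def)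
  have R'0: "R' \<ge> 0" using R0 \<beta> by (simp add: R'_def)
  have T0: "T \<ge> 0" using R'0 d by (simp add: T_def)
  have C0: "C \<ge> 0" using T0 IJ by (simp add: C_def)
  have "tent d r * exp (\<Psi> (smooth a q2 x) - C * a)
      \<le> (\<integral>y. exp (increment_exponent a q q1 x y) * tent d (r + a * (y - b)) \<partial>gauss)"
    if n: "bounded_C2 K c B q q1 q2" and a: "0 < a" "a \<le> 1" and Ca: "C * a \<le> 1" and ba: "\<bar>b\<bar> \<le> \<beta> * a"
    for q q1 q2 a x r b
  proof -
    define z where "z = smooth a q2 x"
    note n' = smooth_bounded_C2[OF n, of a]
    have z: "z < 1" "\<bar>z\<bar> \<le> K"
      using bounded_C2D(3,4)[OF n', of x] c by (auto simp: z_def)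
    have B: "B \<ge> 0" and K: "K \<ge> 0" using bounded_C2D(6,7)[OF n] by auto
    note bd = increment_exponent_bounds[OF n a, of x, folded z_def]
    let ?E = "increment_exponent a q q1 x"
    note [measurable] = increment_exponent_measurable'[OF n, of a x]
    let ?F = "\<lambda>y. exp (?E y) * tent d (r + a * (y - b))"
    have "integrable gauss (\<lambda>y. exp (?E y))"
      using one_step_upper[OF c, of K B] n a by blast
    then have iF: "integrable gauss ?F"
      by (rule Bochner_Integration.integrable_bound)
         (use tent_bounds d in \<open>auto simp: abs_mult intro!: mult_left_le\<close>)
    let ?G = "\<lambda>y. exp (?E (y + b)) * tent d (r + a * y) * exp (- (b * y) - b\<^sup>2 / 2)"
    have iG: "integrable gauss ?G"
      using gauss_shift_integrable[OF _ iF, of b] by simp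
    \<comment> \<open>An even minorant of the shifted exponential factor. The doubly exponential
      term is harmless here because of its negative sign.\<close>
    define H where "H = (\<lambda>y. exp (z * (y\<^sup>2 - 1) / 2 - R' * a * exp \<bar>y\<bar>))"
    have [measurable]: "H \<in> borel_measurable borel" by (simp add: H_def)
    have Heven: "H (- y) = H y" for y by (simp add: H_def)
    have "H y \<le> exp (z * (y\<^sup>2 - 1) / 2)" for y
      using R'0 a by (simp add: H_def)
    then have iH: "integrable gauss H"
      by (intro Bochner_Integration.integrable_bound[OF gauss_quadratic_mgf(1)[OF z(1)]])
         (auto simp: H_def)
    have HT: "integrable gauss (\<lambda>y. H y * tent d (r + a * y))"
      by (rule Bochner_Integration.integrable_bound[OF iH])
         (use tent_bounds d in \<open>auto simp: abs_mult intro!: mult_left_le\<close>)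
    have HT': "integrable gauss (\<lambda>y. H y * tent d (r - a * y))"
      using gauss_reflect_integrable[OF _ HT] by (simp add: Heven)
    have GH: "H y * tent d (r + a * y) \<le> ?G y" for y
    proof -
      have b1: "\<bar>b\<bar> \<le> \<beta>"
        using ba mult_left_mono[OF a(2) \<beta>] by simp
      have e1: "?E (y + b) \<ge> z * ((y + b)\<^sup>2 - 1) / 2 - R * exp \<beta> * a * exp \<bar>y\<bar>"
      proof -
        have "exp \<bar>y + b\<bar> \<le> exp \<beta> * exp \<bar>y\<bar>"
          unfolding mult_exp_exp using b1 by simp
        then have "R * a * exp \<bar>y + b\<bar> \<le> R * a * (exp \<beta> * exp \<bar>y\<bar>)"
          using R0 a by (intro mult_left_mono) auto
        moreover have "\<bar>?E (y + b) - z * ((y + b)\<^sup>2 - 1) / 2\<bar> \<le> R * a * exp \<bar>y + b\<bar>"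
          using bd(1)[of "y + b"] B by (simp add: R_def)
        ultimately show ?thesis by (simp add: mult_ac)
      qed
      have e2: "(1 - z) * (b * y + b\<^sup>2 / 2) \<le> (1 + \<bar>K\<bar>) * (\<beta> + \<beta>\<^sup>2) * a * exp \<bar>y\<bar>"
      proof -
        have "\<bar>b * y + b\<^sup>2 / 2\<bar> \<le> \<bar>b\<bar> * \<bar>y\<bar> + \<bar>b\<bar> * \<bar>b\<bar>"
          by (rule order_trans[OF abs_triangle_ineq]) (simp add: abs_mult power2_eq_square)
        also have "\<dots> \<le> (\<beta> * a) * exp \<bar>y\<bar> + (\<beta> * a) * (\<beta> * exp \<bar>y\<bar>)"
        proof (intro add_mono mult_mono)
          show "\<bar>b\<bar> \<le> \<beta> * exp \<bar>y\<bar>"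
            using b1 mult_left_mono[OF abs_poly_le_exp_abs(1)[of y] \<beta>] by linarith
        qed (use ba \<beta> a abs_poly_le_exp_abs(2)[of y] in auto)
        finally have *: "\<bar>b * y + b\<^sup>2 / 2\<bar> \<le> (\<beta> + \<beta>\<^sup>2) * a * exp \<bar>y\<bar>"
          by (simp add: algebra_simps power2_eq_square)
        have "(1 - z) * (b * y + b\<^sup>2 / 2) \<le> \<bar>1 - z\<bar> * \<bar>b * y + b\<^sup>2 / 2\<bar>"
          by (metis abs_ge_self abs_mult)
        also have "\<dots> \<le> (1 + \<bar>K\<bar>) * ((\<beta> + \<beta>\<^sup>2) * a * exp \<bar>y\<bar>)"
          using z(2) * by (intro mult_mono) auto
        finally show ?thesis by (simp add: mult_ac)
      qed
      have "z * (y\<^sup>2 - 1) / 2 - R' * a * exp \<bar>y\<bar> \<le> ?E (y + b) + (- (b * y) - b\<^sup>2 / 2)"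
      proof -
        have "z * ((y + b)\<^sup>2 - 1) / 2 + (- (b * y) - b\<^sup>2 / 2)
            = z * (y\<^sup>2 - 1) / 2 - (1 - z) * (b * y + b\<^sup>2 / 2)"
          by (simp add: power2_eq_square field_simps)
        moreover have "R' * a * exp \<bar>y\<bar>
            = R * exp \<beta> * a * exp \<bar>y\<bar> + (1 + \<bar>K\<bar>) * (\<beta> + \<beta>\<^sup>2) * a * exp \<bar>y\<bar>"
          by (simp only: R'_def distrib_right)
        ultimately show ?thesis using e1 e2 by linarith
      qed
      then have "H y \<le> exp (?E (y + b)) * exp (- (b * y) - b\<^sup>2 / 2)"
        unfolding mult_exp_exp H_def by simp
      from mult_right_mono[OF this tent_bounds(1)[of d "r + a * y"]]
      show ?thesis by (simp add: mult_ac)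
    qed
    have avg: "tent d r * (exp (z * (y\<^sup>2 - 1) / 2) - a * T * J y)
        \<le> (H y * tent d (r + a * y) + H y * tent d (r - a * y)) / 2" for y
    proof -
      let ?e = "exp (z * (y\<^sup>2 - 1) / 2)"
      have H0: "0 \<le> H y" by (simp add: H_def)
      have Hle: "H y \<le> ?e" using R'0 a by (simp add: H_def)
      have "?e * (1 + - (R' * a * exp \<bar>y\<bar>)) \<le> ?e * exp (- (R' * a * exp \<bar>y\<bar>))"
        by (intro mult_left_mono exp_ge_add_one_self) auto
      also have "\<dots> = H y" by (simp add: H_def mult_exp_exp)
      finally have Hge: "?e - R' * a * exp \<bar>y\<bar> * ?e \<le> H y" by (simp add: algebra_simps)
      have "?e \<le> exp (c * y\<^sup>2 / 2 + K / 2)" using bd(3)[of y] by simp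
      then have "exp \<bar>y\<bar> * ?e \<le> exp \<bar>y\<bar> * exp (c * y\<^sup>2 / 2 + K / 2)"
        by (intro mult_left_mono) auto
      also have "\<dots> = exp (K / 2) * J y" unfolding J_def mult_exp_exp by (simp add: algebra_simps)
      finally have eJ: "exp \<bar>y\<bar> * ?e \<le> exp (K / 2) * J y" .
      have "2 * a / d * (\<bar>y\<bar> * H y) \<le> 2 * a / d * (exp \<bar>y\<bar> * ?e)"
        using H0 Hle a d abs_poly_le_exp_abs(2)[of y] by (intro mult_left_mono mult_mono) auto
      then have "?e - H y * (1 - 2 * \<bar>a * y\<bar> / d) \<le> (R' * a + 2 * a / d) * (exp \<bar>y\<bar> * ?e)"
        using Hge a by (simp add: abs_mult algebra_simps)
      also have "\<dots> \<le> (R' * a + 2 * a / d) * (exp (K / 2) * J y)"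
        using eJ R'0 a d by (intro mult_left_mono) auto
      also have "\<dots> = a * T * J y" by (simp add: T_def algebra_simps)
      finally have "?e - a * T * J y \<le> H y * (1 - 2 * \<bar>a * y\<bar> / d)" by linarith
      then have "tent d r * (?e - a * T * J y) \<le> H y * (tent d r * (1 - 2 * \<bar>a * y\<bar> / d))"
        using mult_left_mono[OF _ tent_bounds(1)] by (subst mult.left_commute) blast
      also have "\<dots> \<le> H y * ((tent d (r + a * y) + tent d (r - a * y)) / 2)"
        by (intro mult_left_mono tent_symmetric_average d H0)
      finally show ?thesis by (simp add: distrib_left)
    qed
    let ?a = "a * T * integral\<^sup>L gauss J"
    have "exp (\<Psi> z - C * a) = exp (\<Psi> z) * exp (- 2 * ?a)"
      unfolding mult_exp_exp by (simp add: C_def)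
    also have "\<dots> \<le> exp (\<Psi> z) * (1 - ?a)"
      using one_minus_ge_exp[of ?a] Ca a T0 IJ by (intro mult_left_mono) (auto simp: C_def mult_ac)
    also have "\<dots> \<le> exp (\<Psi> z) - ?a"
    proof -
      have "1 * ?a \<le> exp (\<Psi> z) * ?a"
        using \<Psi>_nonneg[OF z(1)] a T0 IJ by (intro mult_right_mono) auto
      then show ?thesis by (simp add: algebra_simps)
    qed
    finally have "tent d r * exp (\<Psi> z - C * a) \<le> tent d r * (exp (\<Psi> z) - ?a)"
      by (intro mult_left_mono tent_bounds) auto
    also have "\<dots> = (\<integral>y. tent d r * (exp (z * (y\<^sup>2 - 1) / 2) - a * T * J y) \<partial>gauss)"
      using gauss_quadratic_mgf[OF z(1)] J by simp
    also have "\<dots> \<le> (\<integral>y. (H y * tent d (r + a * y) + H y * tent d (r - a * y)) / 2 \<partial>gauss)"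
      by (rule integral_mono) (use gauss_quadratic_mgf(1)[OF z(1)] J HT HT' avg in auto)
    also have "\<dots> = ((\<integral>y. H y * tent d (r + a * y) \<partial>gauss) + (\<integral>y. H y * tent d (r - a * y) \<partial>gauss)) / 2"
      using HT HT' by simp
    \<comment> \<open>Evenness of \<open>H\<close> is used here: by reflection the symmetrised
      integral equals the one-sided integral.\<close>
    also have "(\<integral>y. H y * tent d (r - a * y) \<partial>gauss) = (\<integral>y. H y * tent d (r + a * y) \<partial>gauss)"
      using gauss_reflect[of "\<lambda>y. H y * tent d (r + a * y)"] by (simp add: Heven)
    also have "((\<integral>y. H y * tent d (r + a * y) \<partial>gauss) + (\<integral>y. H y * tent d (r + a * y) \<partial>gauss)) / 2
        = (\<integral>y. H y * tent d (r + a * y) \<partial>gauss)"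
      by simp
    also have "\<dots> \<le> integral\<^sup>L gauss ?G"
      by (rule integral_mono[OF HT iG GH])
    also have "\<dots> = integral\<^sup>L gauss ?F"
      using gauss_shift[of ?F b] by simp
    finally show ?thesis by (simp add: z_def)
  qed
  then show ?thesis using C0 by blast
qed

section \<open>Multiplicative functionals of a Gaussian random walk\<close>

abbreviation (input) walk :: "real \<Rightarrow> (nat \<Rightarrow> real) \<Rightarrow> nat \<Rightarrow> real" where
  "walk a \<xi> k \<equiv> a * (\<Sum>j<k. \<xi> j)"

text \<open>\<open>G k\<close> is the factor picked up by step k, depending on the position before
  it and on its increment; \<open>w k\<close> is a test function of the position at time k. Values
  in \<open>ennreal\<close> spare all integrability conditions in Fubini.\<close>

context
  fixes a :: real and G :: "nat \<Rightarrow> real \<Rightarrow> real \<Rightarrow> ennreal" and w :: "nat \<Rightarrow> real \<Rightarrow> ennreal"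
  assumes G_measurable: "\<And>k. (\<lambda>p. G k (fst p) (snd p)) \<in> borel_measurable (borel \<Otimes>\<^sub>M borel)"
    and w_measurable [measurable]: "\<And>k. w k \<in> borel_measurable borel"
begin

lemma G_compose [measurable (raw)]:
  assumes "f \<in> borel_measurable N" "h \<in> borel_measurable N"
  shows "(\<lambda>x. G k (f x) (h x)) \<in> borel_measurable N"
  using measurable_compose[OF measurable_Pair[OF assms] G_measurable] by simp

text \<open>The first n factors depend only on the first n coordinates, so the last increment can be
  integrated out conditionally on the position before it.\<close>

lemma gauss_product_step:
  "(\<integral>\<^sup>+\<xi>. (\<Prod>k<Suc n. G k (walk a \<xi> k) (\<xi> k)) * w (Suc n) (walk a \<xi> (Suc n)) \<partial>Pi\<^sub>M {..<Suc n} (\<lambda>_. gauss))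
    = (\<integral>\<^sup>+\<xi>. (\<Prod>k<n. G k (walk a \<xi> k) (\<xi> k)) *
        (\<integral>\<^sup>+y. G n (walk a \<xi> n) y * w (Suc n) (walk a \<xi> n + a * y) \<partial>gauss) \<partial>Pi\<^sub>M {..<n} (\<lambda>_. gauss))"
proof -
  interpret P: product_sigma_finite "\<lambda>_::nat. gauss" ..
  have sum_upd: "(\<Sum>j<k. (\<xi>(n := y)) j) = (\<Sum>j<k. \<xi> j)" if "k \<le> n" for k y and \<xi> :: "nat \<Rightarrow> real"
    using that by (intro sum.cong) auto
  have prod_upd: "(\<Prod>k<n. G k (walk a (\<xi>(n := y)) k) ((\<xi>(n := y)) k)) = (\<Prod>k<n. G k (walk a \<xi> k) (\<xi> k))" for \<xi> y
    by (intro prod.cong) (auto simp: sum_upd simp del: fun_upd_apply, simp)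
  have "{..<Suc n} = insert n {..<n}" by auto
  then have "(\<integral>\<^sup>+\<xi>. (\<Prod>k<Suc n. G k (walk a \<xi> k) (\<xi> k)) * w (Suc n) (walk a \<xi> (Suc n)) \<partial>Pi\<^sub>M {..<Suc n} (\<lambda>_. gauss))
      = (\<integral>\<^sup>+\<xi>. (\<Prod>k<Suc n. G k (walk a \<xi> k) (\<xi> k)) * w (Suc n) (walk a \<xi> (Suc n)) \<partial>Pi\<^sub>M (insert n {..<n}) (\<lambda>_. gauss))"
    by simp
  also have "\<dots> = (\<integral>\<^sup>+\<xi>. \<integral>\<^sup>+y. (\<Prod>k<Suc n. G k (walk a (\<xi>(n := y)) k) ((\<xi>(n := y)) k))
        * w (Suc n) (walk a (\<xi>(n := y)) (Suc n)) \<partial>gauss \<partial>Pi\<^sub>M {..<n} (\<lambda>_. gauss))"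
    by (rule P.product_nn_integral_insert) (auto intro!: borel_measurable_times_ennreal)
  also have "\<dots> = (\<integral>\<^sup>+\<xi>. \<integral>\<^sup>+y. (\<Prod>k<n. G k (walk a \<xi> k) (\<xi> k)) *
        (G n (walk a \<xi> n) y * w (Suc n) (walk a \<xi> n + a * y)) \<partial>gauss \<partial>Pi\<^sub>M {..<n} (\<lambda>_. gauss))"
    unfolding prod.lessThan_Suc prod_upd by (simp add: sum_upd distrib_left mult.assoc del: fun_upd_apply) simp
  also have "\<dots> = (\<integral>\<^sup>+\<xi>. (\<Prod>k<n. G k (walk a \<xi> k) (\<xi> k)) *
        (\<integral>\<^sup>+y. G n (walk a \<xi> n) y * w (Suc n) (walk a \<xi> n + a * y) \<partial>gauss) \<partial>Pi\<^sub>M {..<n} (\<lambda>_. gauss))"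
    by (intro nn_integral_cong nn_integral_cmult) measurable
  finally show ?thesis .
qed

lemma gauss_product_measurable [measurable]:
  "(\<lambda>\<xi>. (\<Prod>k<n. G k (walk a \<xi> k) (\<xi> k)) * w m (walk a \<xi> n)) \<in> borel_measurable (Pi\<^sub>M {..<n} (\<lambda>_. gauss))"
proof -
  have *: "(\<lambda>\<xi>. walk a \<xi> k) \<in> borel_measurable (Pi\<^sub>M {..<n} (\<lambda>_. gauss))" if "k \<le> n" for k
    using that by (intro borel_measurable_times borel_measurable_const borel_measurable_sum
        measurable_compose[OF measurable_component_singleton]) auto
  have "(\<lambda>\<xi>. \<xi> k) \<in> borel_measurable (Pi\<^sub>M {..<n} (\<lambda>_. gauss))" if "k < n" for k
    using that by (intro measurable_compose[OF measurable_component_singleton]) auto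
  then show ?thesis
    by (intro borel_measurable_times_ennreal borel_measurable_prod_ennreal G_compose
        measurable_compose[OF _ w_measurable] *) auto
qed

text \<open>Comparison for a discrete Feynman-Kac recursion: integrating out the last increment
  replaces \<open>w (Suc n)\<close> by at least \<open>c n * w n\<close>, and the remaining n
  factors are covered by induction. The upper bound is the same with supersolutions.\<close>

lemma gauss_product_lower:
  assumes "\<And>k x. k < n \<Longrightarrow> c k * w k x \<le> (\<integral>\<^sup>+y. G k x y * w (Suc k) (x + a * y) \<partial>gauss)"
  shows "(\<Prod>k<n. c k) * w 0 0
    \<le> (\<integral>\<^sup>+\<xi>. (\<Prod>k<n. G k (walk a \<xi> k) (\<xi> k)) * w n (walk a \<xi> n) \<partial>Pi\<^sub>M {..<n} (\<lambda>_. gauss))"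
  using assms
proof (induction n)
  case 0
  then show ?case by (simp add: PiM_empty nn_integral_count_space_finite)
next
  case (Suc n)
  have "(\<Prod>k<Suc n. c k) * w 0 0 = c n * ((\<Prod>k<n. c k) * w 0 0)"
    by (simp add: mult_ac)
  also have "\<dots> \<le> c n * (\<integral>\<^sup>+\<xi>. (\<Prod>k<n. G k (walk a \<xi> k) (\<xi> k)) * w n (walk a \<xi> n) \<partial>Pi\<^sub>M {..<n} (\<lambda>_. gauss))"
    using Suc by (intro mult_left_mono Suc.IH) auto
  also have "\<dots> = (\<integral>\<^sup>+\<xi>. (\<Prod>k<n. G k (walk a \<xi> k) (\<xi> k)) * (c n * w n (walk a \<xi> n)) \<partial>Pi\<^sub>M {..<n} (\<lambda>_. gauss))"
    by (subst nn_integral_cmult[symmetric]) (auto simp: mult_ac)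
  also have "\<dots> \<le> (\<integral>\<^sup>+\<xi>. (\<Prod>k<Suc n. G k (walk a \<xi> k) (\<xi> k)) * w (Suc n) (walk a \<xi> (Suc n)) \<partial>Pi\<^sub>M {..<Suc n} (\<lambda>_. gauss))"
    unfolding gauss_product_step by (intro nn_integral_mono mult_left_mono Suc.prems) auto
  finally show ?case .
qed

lemma gauss_product_upper:
  assumes "\<And>k x. k < n \<Longrightarrow> (\<integral>\<^sup>+y. G k x y * w (Suc k) (x + a * y) \<partial>gauss) \<le> c k * w k x"
  shows "(\<integral>\<^sup>+\<xi>. (\<Prod>k<n. G k (walk a \<xi> k) (\<xi> k)) * w n (walk a \<xi> n) \<partial>Pi\<^sub>M {..<n} (\<lambda>_. gauss))
    \<le> (\<Prod>k<n. c k) * w 0 0"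
  using assms
proof (induction n)
  case 0
  then show ?case by (simp add: PiM_empty nn_integral_count_space_finite)
next
  case (Suc n)
  have "(\<integral>\<^sup>+\<xi>. (\<Prod>k<Suc n. G k (walk a \<xi> k) (\<xi> k)) * w (Suc n) (walk a \<xi> (Suc n)) \<partial>Pi\<^sub>M {..<Suc n} (\<lambda>_. gauss))
     \<le> (\<integral>\<^sup>+\<xi>. (\<Prod>k<n. G k (walk a \<xi> k) (\<xi> k)) * (c n * w n (walk a \<xi> n)) \<partial>Pi\<^sub>M {..<n} (\<lambda>_. gauss))"
    unfolding gauss_product_step by (intro nn_integral_mono mult_left_mono Suc.prems) auto
  also have "\<dots> = c n * (\<integral>\<^sup>+\<xi>. (\<Prod>k<n. G k (walk a \<xi> k) (\<xi> k)) * w n (walk a \<xi> n) \<partial>Pi\<^sub>M {..<n} (\<lambda>_. gauss))"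
    by (subst nn_integral_cmult[symmetric]) (auto simp: mult_ac)
  also have "\<dots> \<le> c n * ((\<Prod>k<n. c k) * w 0 0)"
    using Suc by (intro mult_left_mono Suc.IH) auto
  also have "\<dots> = (\<Prod>k<Suc n. c k) * w 0 0"
    by (simp add: mult_ac)
  finally show ?case .
qed

end

section \<open>Riemann sums and near-optimal paths\<close>

text \<open>By the mean value theorem each increment of the antiderivative \<open>H\<close> over a
  cell is F x / n for a point x of that cell; uniform continuity compares it with the left
  endpoint.\<close>

lemma riemann_sum_tendsto:
  fixes F :: "real \<Rightarrow> real"
  assumes F: "continuous_on {0..1} F"
  shows "(\<lambda>n. 1 / real n * (\<Sum>k<n. F (real k / real n))) \<longlonglongrightarrow> integral {0..1} F"
proof (rule LIMSEQ_I)
  fix r :: real assume r: "r > 0"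
  define H where "H = (\<lambda>t. integral {0..t} F)"
  have H: "(H has_real_derivative F t) (at t within {0..1})" if "t \<in> {0..1}" for t
    using integral_has_real_derivative[OF F that] by (simp add: H_def)
  have "uniformly_continuous_on {0..1} F"
    by (rule compact_uniformly_continuous[OF F]) simp
  then obtain d where d: "d > 0"
      "\<And>s t. s \<in> {0..1} \<Longrightarrow> t \<in> {0..1} \<Longrightarrow> \<bar>t - s\<bar> < d \<Longrightarrow> \<bar>F t - F s\<bar> < r / 2"
    unfolding uniformly_continuous_on_def dist_real_def
    using r by (metis half_gt_zero)
  obtain N :: nat where N: "1 / d < real N" using reals_Archimedean2 by blast
  have "norm (1 / real n * (\<Sum>k<n. F (real k / real n)) - integral {0..1} F) < r" if n: "n \<ge> N" for n
  proof -
    have "0 < 1 / d" using d by simp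
    also note N
    also have "real N \<le> real n" using n by simp
    finally have n0: "n > 0" by simp
    have "1 / d < real n" using N n by linarith
    then have nd: "1 / real n < d" using n0 d by (simp add: field_simps)
    have step: "\<bar>1 / real n * F (real k / real n) - (H (real (Suc k) / real n) - H (real k / real n))\<bar>
        \<le> 1 / real n * (r / 2)" if k: "k < n" for k
    proof -
      let ?s = "real k / real n" and ?t = "real (Suc k) / real n"
      have st: "?s < ?t" "0 \<le> ?s" "?t \<le> 1" "?t - ?s = 1 / real n"
        using k n0 by (auto simp: field_simps)
      have "\<exists>x\<in>{?s<..<?t}. H ?t - H ?s = (*) (F x) (?t - ?s)"
      proof (rule mvt_simple[OF st(1)])
        fix x assume "?s \<le> x" "x \<le> ?t"
        then have "x \<in> {0..1}" "{?s..?t} \<subseteq> {0..1}"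
          using st(2,3) unfolding atLeastatMost_subset_iff atLeastAtMost_iff
          by (blast intro: order_trans)+
        then have "(H has_real_derivative F x) (at x within {?s..?t})"
          by (intro DERIV_subset[OF H]) auto
        then show "(H has_derivative (*) (F x)) (at x within {?s..?t})"
          by (simp add: has_field_derivative_def)
      qed
      then obtain x where x: "?s < x" "x < ?t" "H ?t - H ?s = 1 / real n * F x"
        using st(4) by (auto simp: mult.commute)
      have "\<bar>F ?s - F x\<bar> < r / 2"
      proof (rule d(2))
        show "x \<in> {0..1}" "?s \<in> {0..1}" using x st by (auto simp del: of_nat_Suc divide_nonneg_nonneg)
        show "\<bar>?s - x\<bar> < d" using x st(4) nd by linarith
      qed
      then show ?thesis
        unfolding x(3) right_diff_distrib[symmetric] abs_mult by (intro mult_mono) auto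
    qed
    have "integral {0..1} F = (\<Sum>k<n. H (real (Suc k) / real n) - H (real k / real n))"
      unfolding sum_lessThan_telescope[of "\<lambda>k. H (real k / real n)"]
      using n0 by (simp add: H_def)
    then have "\<bar>1 / real n * (\<Sum>k<n. F (real k / real n)) - integral {0..1} F\<bar>
        = \<bar>\<Sum>k<n. 1 / real n * F (real k / real n) - (H (real (Suc k) / real n) - H (real k / real n))\<bar>"
      by (simp add: sum_subtractf sum_distrib_left)
    also have "\<dots> \<le> (\<Sum>k<n. 1 / real n * (r / 2))"
      by (rule order_trans[OF sum_abs]) (intro sum_mono step, simp)
    also have "\<dots> < r" using n0 r by simp
    finally show ?thesis by simp
  qed
  then show "\<exists>N. \<forall>n\<ge>N. norm (1 / real n * (\<Sum>k<n. F (real k / real n)) - integral {0..1} F) < r"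
    by blast
qed

lemma set_lebesgue_integral_01:
  fixes F :: "real \<Rightarrow> real"
  assumes "continuous_on {0..1} F"
  shows "set_integrable lborel {0..1} F" "(LBINT t:{0..1}. F t) = integral {0..1} F"
proof -
  show i: "set_integrable lborel {0..1} F"
    unfolding set_integrable_def using assms by (intro borel_integrable_compact) auto
  show "(LBINT t:{0..1}. F t) = integral {0..1} F"
    by (rule set_borel_integral_eq_integral(2)[OF i])
qed

section \<open>Lipschitz paths with prescribed plateaus\<close>

definition clamp01 :: "real \<Rightarrow> real" where
  "clamp01 t = max 0 (min 1 t)"

lemma clamp01_lipschitz: "\<bar>clamp01 s - clamp01 t\<bar> \<le> \<bar>s - t\<bar>"
  by (auto simp: clamp01_def max_def min_def)

text \<open>A sum of ramps: the i-th starts at time i/m, lasts \<eta>, and moves the path to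
  \<open>x i\<close>. The Lipschitz constant may be huge, since it only enters terms that vanish as
  n grows.\<close>

lemma lipschitz_path_through_points:
  fixes x :: "nat \<Rightarrow> real"
  assumes \<eta>: "\<eta> > 0"
  shows "\<exists>\<gamma> L. (\<forall>s t. \<bar>\<gamma> s - \<gamma> t\<bar> \<le> L * \<bar>s - t\<bar>) \<and> L \<ge> 0 \<and> \<gamma> 0 = 0 \<and>
    (\<forall>i<m. \<forall>t. real i / real m + \<eta> \<le> t \<longrightarrow> t \<le> real (Suc i) / real m \<longrightarrow> \<gamma> t = x i)"
proof -
  \<comment> \<open>Ramp heights; the initial value 0 makes the path start where W does.\<close>
  define e where "e i = x i - (case i of 0 \<Rightarrow> 0 | Suc j \<Rightarrow> x j)" for i
  define \<gamma> where "\<gamma> t = (\<Sum>i<m. e i * clamp01 ((t - real i / real m) / \<eta>))" for t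
  define L where "L = (\<Sum>i<m. \<bar>e i\<bar>) / \<eta>"
  have telescope: "(\<Sum>j\<le>i. e j) = x i" for i
    by (induction i) (auto simp: e_def)
  have "\<bar>\<gamma> s - \<gamma> t\<bar> \<le> L * \<bar>s - t\<bar>" for s t
  proof -
    have "\<bar>\<gamma> s - \<gamma> t\<bar> = \<bar>\<Sum>i<m. e i * (clamp01 ((s - real i / real m) / \<eta>) - clamp01 ((t - real i / real m) / \<eta>))\<bar>"
      by (simp add: \<gamma>_def sum_subtractf right_diff_distrib)
    also have "\<dots> \<le> (\<Sum>i<m. \<bar>e i\<bar> * (\<bar>s - t\<bar> / \<eta>))"
    proof (rule order_trans[OF sum_abs], rule sum_mono)
      fix i
      have "\<bar>clamp01 ((s - real i / real m) / \<eta>) - clamp01 ((t - real i / real m) / \<eta>)\<bar>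
          \<le> \<bar>(s - real i / real m) / \<eta> - (t - real i / real m) / \<eta>\<bar>"
        by (rule clamp01_lipschitz)
      also have "\<dots> = \<bar>s - t\<bar> / \<eta>"
        using \<eta> by (simp flip: diff_divide_distrib)
      finally show "\<bar>e i * (clamp01 ((s - real i / real m) / \<eta>) - clamp01 ((t - real i / real m) / \<eta>))\<bar>
          \<le> \<bar>e i\<bar> * (\<bar>s - t\<bar> / \<eta>)"
        unfolding abs_mult by (intro mult_left_mono) auto
    qed
    also have "\<dots> = L * \<bar>s - t\<bar>"
      by (simp add: L_def sum_distrib_right flip: sum_divide_distrib)
    finally show ?thesis .
  qed
  moreover have "L \<ge> 0" using \<eta> by (simp add: L_def sum_nonneg)
  moreover have "\<gamma> 0 = 0"
    using \<eta> by (auto simp: \<gamma>_def clamp01_def intro!: sum.neutral max_absorb1 min.coboundedI2)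
  moreover have "\<gamma> t = x i"
    if i: "i < m" and t: "real i / real m + \<eta> \<le> t" "t \<le> real (Suc i) / real m" for i t
  proof -
    have "e j * clamp01 ((t - real j / real m) / \<eta>) = (if j \<le> i then e j else 0)" if "j < m" for j
    proof (cases "j \<le> i")
      case True
      then have "real j / real m \<le> real i / real m" by (simp add: divide_right_mono)
      then have "1 \<le> (t - real j / real m) / \<eta>" using t(1) \<eta> by (simp add: field_simps)
      then show ?thesis using True by (simp add: clamp01_def)
    next
      case False
      then have "real (Suc i) / real m \<le> real j / real m"
        by (intro divide_right_mono) auto
      then have "(t - real j / real m) / \<eta> \<le> 0" using t(2) \<eta> by (simp add: divide_le_0_iff)
      then show ?thesis using False by (simp add: clamp01_def)
    qed
    then have "\<gamma> t = (\<Sum>j<m. if j \<le> i then e j else 0)"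
      unfolding \<gamma>_def by (intro sum.cong) auto
    also have "\<dots> = (\<Sum>j\<le>i. e j)"
      using i by (simp add: sum.If_cases) (intro sum.cong, auto)
    finally show ?thesis by (simp add: telescope)
  qed
  ultimately show ?thesis by blast
qed

text \<open>Abstracts \<open>\<Psi>\<close> of u_xx as a reward collected along a path. Time
  regularity is only of order 1/2 because the averaging scale sqrt (1 - t) is no better near t =
  1.\<close>

locale running_reward =
  fixes P :: "real \<Rightarrow> real \<Rightarrow> real" and Pm L H :: real
  assumes P_nonneg: "\<And>t x. t \<in> {0..1} \<Longrightarrow> 0 \<le> P t x"
    and P_le: "\<And>t x. t \<in> {0..1} \<Longrightarrow> P t x \<le> Pm"
    and P_lipschitz: "\<And>t x y. t \<in> {0..1} \<Longrightarrow> \<bar>P t x - P t y\<bar> \<le> L * \<bar>x - y\<bar>"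
    and P_holder: "\<And>s t x. s \<in> {0..1} \<Longrightarrow> t \<in> {0..1} \<Longrightarrow> \<bar>P s x - P t x\<bar> \<le> H * sqrt \<bar>s - t\<bar>"
begin

definition best :: "real \<Rightarrow> real" where
  "best t = (SUP x. P t x)"

lemma P_le_best: "t \<in> {0..1} \<Longrightarrow> P t x \<le> best t"
  unfolding best_def using P_le by (intro cSUP_upper) (auto intro!: bdd_aboveI2)

lemma best_le: "t \<in> {0..1} \<Longrightarrow> best t \<le> Pm"
  unfolding best_def by (rule cSUP_least) (auto intro: P_le)

lemma best_approx:
  assumes "t \<in> {0..1}" "e > 0"
  shows "\<exists>x. best t - e < P t x"
proof -
  have "\<exists>x\<in>UNIV. best t - e < P t x"
    using assms P_le unfolding best_def
    by (subst less_cSUP_iff[symmetric]) (auto intro!: bdd_aboveI2)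
  then show ?thesis by blast
qed

lemma best_holder:
  assumes "s \<in> {0..1}" "t \<in> {0..1}"
  shows "\<bar>best s - best t\<bar> \<le> H * sqrt \<bar>s - t\<bar>"
proof -
  have "best s \<le> best t + H * sqrt \<bar>s - t\<bar>" if "s \<in> {0..1}" "t \<in> {0..1}" for s t
    unfolding best_def[of s]
  proof (rule cSUP_least)
    show "P s x \<le> best t + H * sqrt \<bar>s - t\<bar>" for x
      using P_holder[OF that, of x] P_le_best[OF that(2), of x] by linarith
  qed simp
  from this[OF assms] this[OF assms(2,1)] show ?thesis
    by (simp add: abs_le_iff abs_minus_commute)
qed

lemma continuous_on_path:
  assumes \<gamma>: "\<And>s t. \<bar>\<gamma> s - \<gamma> t\<bar> \<le> B * \<bar>s - t\<bar>"
  shows "continuous_on {0..1} (\<lambda>t. P t (\<gamma> t))"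
  unfolding continuous_on_def
proof
  fix t :: real assume t: "t \<in> {0..1}"
  have "((\<lambda>s. P s (\<gamma> s) - P t (\<gamma> t)) \<longlongrightarrow> 0) (at t within {0..1})"
  proof (rule Lim_null_comparison)
    have "\<bar>P s (\<gamma> s) - P t (\<gamma> t)\<bar> \<le> H * sqrt \<bar>s - t\<bar> + \<bar>L\<bar> * (B * \<bar>s - t\<bar>)" if "s \<in> {0..1}" for s
    proof -
      have "\<bar>P t (\<gamma> s) - P t (\<gamma> t)\<bar> \<le> L * \<bar>\<gamma> s - \<gamma> t\<bar>" by (rule P_lipschitz[OF t])
      also have "\<dots> \<le> \<bar>L\<bar> * (B * \<bar>s - t\<bar>)" by (intro mult_mono \<gamma>) auto
      finally show ?thesis using P_holder[OF that t, of "\<gamma> s"] by linarith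
    qed
    then show "\<forall>\<^sub>F s in at t within {0..1}. norm (P s (\<gamma> s) - P t (\<gamma> t))
        \<le> H * sqrt \<bar>s - t\<bar> + \<bar>L\<bar> * (B * \<bar>s - t\<bar>)"
      by (auto simp: eventually_at_filter)
    show "((\<lambda>s. H * sqrt \<bar>s - t\<bar> + \<bar>L\<bar> * (B * \<bar>s - t\<bar>)) \<longlongrightarrow> 0) (at t within {0..1})"
      by (auto intro!: tendsto_eq_intros)
  qed
  then show "((\<lambda>s. P s (\<gamma> s)) \<longlongrightarrow> P t (\<gamma> t)) (at t within {0..1})"
    by (rule LIM_zero_cancel)
qed

lemma continuous_on_best: "continuous_on {0..1} best"
  unfolding continuous_on_def
proof
  fix t :: real assume t: "t \<in> {0..1}"
  have "((\<lambda>s. best s - best t) \<longlongrightarrow> 0) (at t within {0..1})"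
  proof (rule Lim_null_comparison)
    show "\<forall>\<^sub>F s in at t within {0..1}. norm (best s - best t) \<le> H * sqrt \<bar>s - t\<bar>"
      using best_holder[OF _ t] by (auto simp: eventually_at_filter)
    show "((\<lambda>s. H * sqrt \<bar>s - t\<bar>) \<longlongrightarrow> 0) (at t within {0..1})"
      by (auto intro!: tendsto_eq_intros)
  qed
  then show "(best \<longlongrightarrow> best t) (at t within {0..1})"
    by (rule LIM_zero_cancel)
qed

text \<open>Stay at a near-maximiser chosen at the left end of each of m cells, and spend only a
  short ramp of each cell on moving. Half of \<open>e\<close> pays for the plateaus and half for the
  ramps.\<close>

lemma near_optimal_path:
  assumes e: "e > 0"
  shows "\<exists>\<gamma> B. (\<forall>s t. \<bar>\<gamma> s - \<gamma> t\<bar> \<le> B * \<bar>s - t\<bar>) \<and> B \<ge> 0 \<and> \<gamma> 0 = 0 \<and>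
    integral {0..1} best - e \<le> integral {0..1} (\<lambda>t. P t (\<gamma> t))"
proof -
  have Pm: "0 \<le> Pm" using P_nonneg[of 0 0] P_le[of 0 0] by simp
  have H: "0 \<le> H"
    using P_holder[of 0 1 0] by (simp add: order_trans[OF abs_ge_zero])
  \<comment> \<open>This makes the oscillation over a cell at most e/6. On a plateau three such
    errors add up to e/2: the choice of \<open>x i\<close>, the change of \<open>P\<close> and the
    change of \<open>best\<close>.\<close>
  obtain m :: nat where m0: "m > 0" and m: "(6 * H / e)\<^sup>2 \<le> real m"
  proof -
    obtain m :: nat where "(6 * H / e)\<^sup>2 < real m" using reals_Archimedean2 by blast
    moreover from this have "m > 0"
      using zero_le_power2[of "6 * H / e"] by (cases m) (auto simp del: zero_le_power2)
    ultimately show ?thesis using that by force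
  qed
  have Hm: "H * sqrt \<bar>s - t\<bar> \<le> e / 6" if "\<bar>s - t\<bar> \<le> 1 / real m" for s t
  proof -
    have "6 * H / e \<le> sqrt (real m)"
      using m by (intro real_le_rsqrt)
    then have "H \<le> e / 6 * sqrt (real m)" using e by (simp add: field_simps)
    then have "H * sqrt \<bar>s - t\<bar> \<le> (e / 6 * sqrt (real m)) * sqrt (1 / real m)"
      using that e by (intro mult_mono) auto
    also have "\<dots> = e / 6" using m0 by (simp add: real_sqrt_divide)
    finally show ?thesis .
  qed
  \<comment> \<open>The ramps have total length m \<eta>, and each unit of time loses at most
    \<open>Pm\<close>; the +1 avoids division by zero.\<close>
  define \<eta> where "\<eta> = e / (2 * real m * (Pm + 1))"
  have \<eta>: "\<eta> > 0" using e m0 Pm by (simp add: \<eta>_def)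
  have m\<eta>: "Pm * (real m * \<eta>) \<le> e / 2"
  proof -
    have "Pm * (real m * \<eta>) = e / 2 * (Pm / (Pm + 1))" using m0 by (simp add: \<eta>_def)
    also have "\<dots> \<le> e / 2 * 1" using Pm e by (intro mult_left_mono) auto
    finally show ?thesis by simp
  qed
  have im: "real i / real m \<in> {0..1}" if "i < m" for i using that by auto
  have "\<exists>x. best (real i / real m) - e / 6 < P (real i / real m) x" if "i < m" for i
    using best_approx[OF im[OF that], of "e / 6"] e by simp
  then obtain x where x: "\<And>i. i < m \<Longrightarrow> best (real i / real m) - e / 6 < P (real i / real m) (x i)"
    by metis
  obtain \<gamma> B where \<gamma>: "\<And>s t. \<bar>\<gamma> s - \<gamma> t\<bar> \<le> B * \<bar>s - t\<bar>" "B \<ge> 0" "\<gamma> 0 = 0"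
      "\<And>i t. i < m \<Longrightarrow> real i / real m + \<eta> \<le> t \<Longrightarrow> t \<le> real (Suc i) / real m \<Longrightarrow> \<gamma> t = x i"
    using lipschitz_path_through_points[OF \<eta>, of m x] by blast
  let ?F = "\<lambda>t. P t (\<gamma> t)"
  have cF: "continuous_on {0..1} ?F" by (rule continuous_on_path[OF \<gamma>(1)])
  let ?I = "\<lambda>i. {real i / real m .. real i / real m + \<eta>}"
  have pt: "best t - ?F t \<le> e / 2 + Pm * (\<Sum>i<m. indicator (?I i) t)" if t: "t \<in> {0..1}" for t
  proof -
    \<comment> \<open>At t = 1 the floor of t m would be m, so the last cell is taken
      instead.\<close>
    obtain i where i: "i < m" "real i / real m \<le> t" "t \<le> real (Suc i) / real m"
    proof (cases "t = 1")
      case True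
      then show ?thesis using that[of "m - 1"] m0 by (simp add: of_nat_diff)
    next
      case False
      define i where "i = nat \<lfloor>t * real m\<rfloor>"
      have ri: "real i = of_int \<lfloor>t * real m\<rfloor>" using t by (simp add: i_def)
      have le: "real i \<le> t * real m" "t * real m < real i + 1" unfolding ri by linarith+
      have "t * real m < 1 * real m" using t False m0 by (intro mult_strict_right_mono) auto
      then have "i < m" using le by linarith
      then show ?thesis using that[of i] le m0 by (simp add: field_simps)
    qed
    show ?thesis
    proof (cases "t \<in> ?I i")
      case True
      have "1 = (\<Sum>j\<in>{i}. indicator (?I j) t :: real)" using True by simp
      also have "\<dots> \<le> (\<Sum>j<m. indicator (?I j) t)" using i by (intro sum_mono2) auto
      finally have "Pm * 1 \<le> Pm * (\<Sum>j<m. indicator (?I j) t)" using Pm by (intro mult_left_mono)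
      then show ?thesis using best_le[OF t] P_nonneg[OF t, of "\<gamma> t"] e by linarith
    next
      case False
      then have rest: "\<gamma> t = x i" using i by (intro \<gamma>(4)) auto
      have "H * sqrt \<bar>real i / real m - t\<bar> \<le> e / 6"
        using i by (intro Hm) (simp add: add_divide_distrib abs_le_iff)
      moreover have "0 \<le> Pm * (\<Sum>i<m. indicator (?I i) t)" using Pm by (simp add: sum_nonneg)
      ultimately show ?thesis
        unfolding rest using x[OF i(1)] P_holder[OF im[OF i(1)] t, of "x i"] best_holder[OF im[OF i(1)] t]
          e by linarith
    qed
  qed
  have ib: "set_integrable lborel {0..1} best" and iF: "set_integrable lborel {0..1} ?F"
    using set_lebesgue_integral_01 continuous_on_best cF by auto
  have "integral {0..1} best - integral {0..1} ?F = (LBINT t:{0..1}. best t - ?F t)"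
    using set_lebesgue_integral_01(2)[OF continuous_on_best] set_lebesgue_integral_01(2)[OF cF]
    by (simp add: set_integral_diff(2)[OF ib iF])
  also have "\<dots> \<le> (\<integral>t. e / 2 * indicator {0..1} t + Pm * (\<Sum>i<m. indicator (?I i) t) \<partial>lborel)"
    unfolding set_lebesgue_integral_def
  proof (rule integral_mono)
    show "integrable lborel (\<lambda>t. indicator {0..1} t *\<^sub>R (best t - ?F t))"
      using set_integral_diff(1)[OF ib iF] by (simp add: set_integrable_def)
    show "integrable lborel (\<lambda>t. e / 2 * indicator {0..1} t + Pm * (\<Sum>i<m. indicator (?I i) t) :: real)"
      by (intro Bochner_Integration.integrable_add integrable_mult_right
          Bochner_Integration.integrable_sum integrable_real_indicator)
         (auto simp: emeasure_lborel_Icc_eq)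
    show "indicator {0..1} t *\<^sub>R (best t - ?F t) \<le> e / 2 * indicator {0..1} t + Pm * (\<Sum>i<m. indicator (?I i) t)" for t
      using pt[of t] Pm by (cases "t \<in> {0..1}") (auto simp: sum_nonneg)
  qed
  also have "\<dots> = e / 2 + Pm * (real m * \<eta>)"
  proof -
    have "(\<integral>t. e / 2 * indicator {0..1} t + Pm * (\<Sum>i<m. indicator (?I i) t) \<partial>lborel)
        = e / 2 * measure lborel {0..1::real} + Pm * (\<Sum>i<m. measure lborel (?I i))"
      by (subst Bochner_Integration.integral_add)
         (auto intro!: integrable_mult_right Bochner_Integration.integrable_sum integrable_real_indicator
           simp: Bochner_Integration.integral_sum emeasure_lborel_Icc_eq)
    then show ?thesis using \<eta> by simp
  qed
  finally have "integral {0..1} best - e \<le> integral {0..1} ?F" using m\<eta> by linarith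
  then show ?thesis using \<gamma>(1-3) by blast
qed

text \<open>The constant in \<open>lower\<close> may depend on the path and on d, because both are
  fixed before n tends to infinity.\<close>

lemma log_rate_tendsto:
  assumes upper: "\<And>n::nat. n \<ge> 1 \<Longrightarrow> Z n \<le> (\<Sum>k<n. best (real k / real n)) + C * sqrt (real n)"
    and lower: "\<And>\<gamma> B d. (\<And>s t. \<bar>\<gamma> s - \<gamma> t\<bar> \<le> B * \<bar>s - t\<bar>) \<Longrightarrow> B \<ge> 0 \<Longrightarrow> \<gamma> 0 = 0 \<Longrightarrow> d > 0 \<Longrightarrow>
      \<exists>C. \<forall>\<^sub>F n in sequentially. (\<Sum>k<n. P (real k / real n) (\<gamma> (real k / real n))) - real n * d - C * sqrt (real n) \<le> Z n"
  shows "(\<lambda>n. 1 / real n * Z n) \<longlonglongrightarrow> integral {0..1} best"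
proof (rule order_tendstoI)
  have rsq: "(\<lambda>n. 1 / real n * (C * sqrt (real n))) \<longlonglongrightarrow> 0" for C
    by real_asymp
  fix l assume l: "integral {0..1} best < l"
  have "(\<lambda>n. 1 / real n * (\<Sum>k<n. best (real k / real n)) + 1 / real n * (C * sqrt (real n)))
      \<longlonglongrightarrow> integral {0..1} best + 0"
    by (intro tendsto_add riemann_sum_tendsto continuous_on_best rsq)
  then have "\<forall>\<^sub>F n in sequentially. 1 / real n * (\<Sum>k<n. best (real k / real n)) + 1 / real n * (C * sqrt (real n)) < l"
    using l by (intro order_tendstoD) auto
  then show "\<forall>\<^sub>F n in sequentially. 1 / real n * Z n < l"
    using eventually_ge_at_top[of 1]
  proof eventually_elim
    case (elim n)
    have "1 / real n * Z n \<le> 1 / real n * ((\<Sum>k<n. best (real k / real n)) + C * sqrt (real n))"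
      using elim by (intro mult_left_mono upper) auto
    then show ?case using elim by (simp only: distrib_left)
  qed
next
  have rsq: "(\<lambda>n. 1 / real n * (C * sqrt (real n))) \<longlonglongrightarrow> 0" for C
    by real_asymp
  fix l assume l: "l < integral {0..1} best"
  \<comment> \<open>One third for the suboptimal path, one for the tube, and one to keep the
    inequality strict.\<close>
  define e where "e = (integral {0..1} best - l) / 3"
  have e: "e > 0" using l by (simp add: e_def)
  obtain \<gamma> B where \<gamma>: "\<And>s t. \<bar>\<gamma> s - \<gamma> t\<bar> \<le> B * \<bar>s - t\<bar>" "B \<ge> 0" "\<gamma> 0 = 0"
      "integral {0..1} best - e \<le> integral {0..1} (\<lambda>t. P t (\<gamma> t))"
    using near_optimal_path[OF e] by blast
  obtain C where C: "\<forall>\<^sub>F n in sequentially.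
      (\<Sum>k<n. P (real k / real n) (\<gamma> (real k / real n))) - real n * e - C * sqrt (real n) \<le> Z n"
    using lower[OF \<gamma>(1,2,3) e] by blast
  have "(\<lambda>n. 1 / real n * (\<Sum>k<n. P (real k / real n) (\<gamma> (real k / real n))) - e - 1 / real n * (C * sqrt (real n)))
      \<longlonglongrightarrow> integral {0..1} (\<lambda>t. P t (\<gamma> t)) - e - 0"
    by (intro tendsto_diff riemann_sum_tendsto continuous_on_path[OF \<gamma>(1)] rsq tendsto_const)
  moreover have "l < integral {0..1} (\<lambda>t. P t (\<gamma> t)) - e - 0"
    using \<gamma>(4) e by (simp add: e_def field_simps)
  ultimately have "\<forall>\<^sub>F n in sequentially.
      l < 1 / real n * (\<Sum>k<n. P (real k / real n) (\<gamma> (real k / real n))) - e - 1 / real n * (C * sqrt (real n))"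
    by (rule order_tendstoD(1))
  then show "\<forall>\<^sub>F n in sequentially. l < 1 / real n * Z n"
    using C eventually_ge_at_top[of 1]
  proof eventually_elim
    case (elim n)
    have "1 / real n * ((\<Sum>k<n. P (real k / real n) (\<gamma> (real k / real n))) - real n * e - C * sqrt (real n)) \<le> 1 / real n * Z n"
      using elim by (intro mult_left_mono) auto
    moreover have "1 / real n * (real n * e) = e" using elim by simp
    ultimately show ?case using elim(1) by (simp only: right_diff_distrib)
  qed
qed

end

section \<open>The hedging error\<close>

text \<open>Both averages are driven by the same Gaussian variable, so the arguments differ by only
  |a - b| |y|.\<close>

lemma smooth_scale_lipschitz:
  assumes n: "bounded_C2 K c B q q1 q2"
  shows "\<bar>smooth a q2 x - smooth b q2 x\<bar> \<le> B * gauss_moment * \<bar>a - b\<bar>"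
proof -
  note g = bounded_C2_exp_growth(3)[OF n]
  note [measurable] = exp_growth_measurable[OF g]
  have "\<bar>smooth a q2 x - smooth b q2 x\<bar> = \<bar>\<integral>y. q2 (x + a * y) - q2 (x + b * y) \<partial>gauss\<bar>"
    by (simp add: smooth_def exp_growth_integrable[OF g])
  also have "\<dots> \<le> B * \<bar>a - b\<bar> * gauss_moment"
  proof (rule gauss_average_bound(2))
    fix y
    have "\<bar>q2 (x + a * y) - q2 (x + b * y)\<bar> \<le> B * \<bar>(a - b) * y\<bar>"
      using bounded_C2D(5)[OF n, of "x + a * y" "x + b * y"] by (simp add: left_diff_distrib)
    also have "\<dots> \<le> B * \<bar>a - b\<bar> * exp \<bar>y\<bar>"
      unfolding abs_mult mult.assoc
      using bounded_C2D(7)[OF n] by (intro mult_left_mono abs_poly_le_exp_abs) auto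
    finally show "\<bar>q2 (x + a * y) - q2 (x + b * y)\<bar> \<le> B * \<bar>a - b\<bar> * exp \<bar>y\<bar>" .
  qed simp
  finally show ?thesis by (simp add: mult_ac)
qed

section \<open>Reduction of Brownian expectations to independent standard Gaussians\<close>

context standard_brownian_motion
begin

lemma increment_distr:
  assumes "0 \<le> s" "s < t"
  shows "distr M borel (\<lambda>\<omega>. (W t \<omega> - W s \<omega>) / sqrt (t - s)) = gauss"
proof -
  have "distributed M lborel (\<lambda>\<omega>. 0 + 1 / sqrt (t - s) * (W t \<omega> - W s \<omega>))
      (normal_density (0 + 1 / sqrt (t - s) * 0) (\<bar>1 / sqrt (t - s)\<bar> * sqrt (t - s)))"
    by (intro normal_density_affine gaussian_increments assms) (use assms in auto)
  then have "distributed M lborel (\<lambda>\<omega>. (W t \<omega> - W s \<omega>) / sqrt (t - s)) std_normal_density"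
    using assms by simp
  then have "distr M lborel (\<lambda>\<omega>. (W t \<omega> - W s \<omega>) / sqrt (t - s)) = gauss"
    by (rule distributed_distr_eq_density)
  moreover have "distr M lborel (\<lambda>\<omega>. (W t \<omega> - W s \<omega>) / sqrt (t - s))
      = distr M borel (\<lambda>\<omega>. (W t \<omega> - W s \<omega>) / sqrt (t - s))"
    by (intro distr_cong) auto
  ultimately show ?thesis by simp
qed

text \<open>At t = 1 the increment is degenerate and has no density, hence the case split. W 0
  vanishes only almost surely, hence the AE congruences.\<close>

lemma u_eq_smooth:
  assumes [measurable]: "f \<in> borel_measurable borel" and t: "t \<in> {0..1}"
  shows "u M W f t = smooth (sqrt (1 - t)) f"
proof
  fix x
  have [measurable]: "W s \<in> borel_measurable M" if "0 \<le> s" for s by (rule random_variable_W[OF that])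
  have t': "0 \<le> 1 - t" using t by simp
  note [measurable] = random_variable_W[OF t']
  show "u M W f t x = smooth (sqrt (1 - t)) f x"
  proof (cases "t = 1")
    case True
    have "u M W f t x = (\<integral>\<omega>. f x \<partial>M)"
      unfolding u_def using start_zero True by (intro integral_cong_AE) auto
    then show ?thesis using True prob_space by simp
  next
    case False
    then have t1: "0 < 1 - t" using t by simp
    let ?X = "\<lambda>\<omega>. (W (1 - t) \<omega> - W 0 \<omega>) / sqrt (1 - t - 0)"
    have "smooth (sqrt (1 - t)) f x = (\<integral>y. f (x + sqrt (1 - t) * y) \<partial>distr M borel ?X)"
      unfolding smooth_def increment_distr[OF order_refl t1] ..
    also have "\<dots> = (\<integral>\<omega>. f (x + sqrt (1 - t) * ?X \<omega>) \<partial>M)"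
      by (subst integral_distr) auto
    also have "\<dots> = u M W f t x"
      unfolding u_def using start_zero t1 by (intro integral_cong_AE) auto
    finally show ?thesis by simp
  qed
qed

definition increment :: "nat \<Rightarrow> nat \<Rightarrow> 'a \<Rightarrow> real" where
  "increment n k \<omega> = (W (real (Suc k) / real n) \<omega> - W (real k / real n) \<omega>) / sqrt (1 / real n)"

lemma increment_measurable [measurable]: "increment n k \<in> borel_measurable M"
proof -
  have [measurable]: "W (real (Suc k) / real n) \<in> borel_measurable M" "W (real k / real n) \<in> borel_measurable M"
    by (auto intro!: random_variable_W divide_nonneg_nonneg)
  show ?thesis unfolding increment_def by measurable
qed

text \<open>Independence and normality together say that the vector of normalised increments has a
  product Gaussian law. It is restricted to \<open>{..<n}\<close> because points of the product
  space are undefined outside the index set.\<close>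

lemma nn_integral_increments:
  assumes n: "n \<ge> 1" and F: "F \<in> borel_measurable (Pi\<^sub>M {..<n} (\<lambda>_. gauss))"
  shows "(\<integral>\<^sup>+\<omega>. F (\<lambda>k\<in>{..<n}. increment n k \<omega>) \<partial>M) = (\<integral>\<^sup>+\<xi>. F \<xi> \<partial>Pi\<^sub>M {..<n} (\<lambda>_. gauss))"
proof -
  have "indep_vars (\<lambda>_. borel) (\<lambda>i \<omega>. W (real (Suc i) / real n) \<omega> - W (real i / real n) \<omega>) {..<n}"
    by (rule indep_increments) (auto intro!: divide_right_mono)
  then have "indep_vars (\<lambda>_. borel) (increment n) {..<n}"
    unfolding increment_def
    by (rule indep_vars_compose2[where Y = "\<lambda>_ x. x / sqrt (1 / real n)"]) auto
  then have "distr M (\<Pi>\<^sub>M i\<in>{..<n}. borel) (\<lambda>\<omega>. \<lambda>k\<in>{..<n}. increment n k \<omega>)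
      = (\<Pi>\<^sub>M k\<in>{..<n}. distr M borel (increment n k))"
    using n by (subst (asm) indep_vars_iff_distr_eq_PiM) (auto simp: lessThan_empty_iff)
  also have "\<dots> = Pi\<^sub>M {..<n} (\<lambda>_. gauss)"
  proof (intro PiM_cong refl)
    fix k
    have lt: "real k / real n < real (Suc k) / real n" "real (Suc k) / real n - real k / real n = 1 / real n"
      using n by (auto simp: field_simps)
    show "distr M borel (increment n k) = gauss"
      using increment_distr[OF _ lt(1)] unfolding lt(2) increment_def by simp
  qed
  finally have D: "distr M (\<Pi>\<^sub>M i\<in>{..<n}. borel) (\<lambda>\<omega>. \<lambda>k\<in>{..<n}. increment n k \<omega>) = Pi\<^sub>M {..<n} (\<lambda>_. gauss)" .
  have "sets (Pi\<^sub>M {..<n} (\<lambda>_. gauss)) = sets (\<Pi>\<^sub>M i\<in>{..<n}. borel)"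
    by (intro sets_PiM_cong) auto
  with F have F': "F \<in> borel_measurable (\<Pi>\<^sub>M i\<in>{..<n}. borel)"
    by (simp cong: measurable_cong_sets)
  show ?thesis
    unfolding D[symmetric] by (subst nn_integral_distr) (use F' in auto)
qed

lemma walk_increment:
  assumes "n \<ge> 1" "W 0 \<omega> = 0"
  shows "sqrt (1 / real n) * (\<Sum>j<k. increment n j \<omega>) = W (real k / real n) \<omega>"
proof -
  have "sqrt (1 / real n) * (\<Sum>j<k. increment n j \<omega>)
      = (\<Sum>j<k. W (real (Suc j) / real n) \<omega> - W (real j / real n) \<omega>)"
    using assms(1) by (simp add: increment_def sum_distrib_left)
  also have "\<dots> = W (real k / real n) \<omega>"
    unfolding sum_lessThan_telescope[of "\<lambda>j. W (real j / real n) \<omega>"] using assms(2) by simp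
  finally show ?thesis .
qed

end

locale hedged_claim = standard_brownian_motion M W for M :: "'a measure" and W +
  fixes f f1 f2 :: "real \<Rightarrow> real" and K c B :: real
  assumes bounded_C2_f: "bounded_C2 K c B f f1 f2" and c: "0 \<le> c" "c < 1"
begin

abbreviation U :: "real \<Rightarrow> real \<Rightarrow> real" where "U t \<equiv> smooth (sqrt (1 - t)) f"
abbreviation U1 :: "real \<Rightarrow> real \<Rightarrow> real" where "U1 t \<equiv> smooth (sqrt (1 - t)) f1"
abbreviation U2 :: "real \<Rightarrow> real \<Rightarrow> real" where "U2 t \<equiv> smooth (sqrt (1 - t)) f2"

lemma bounded_C2_U: "bounded_C2 K c B (U t) (U1 t) (U2 t)"
  by (rule smooth_bounded_C2[OF bounded_C2_f])

lemma u_eq: "t \<in> {0..1} \<Longrightarrow> u M W f t = U t"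
  using bounded_C2_exp_growth(1)[OF bounded_C2_f] by (intro u_eq_smooth exp_growth_measurable)

lemma u_x_eq: "t \<in> {0..1} \<Longrightarrow> u_x M W f t = U1 t"
  using bounded_C2D(1)[OF bounded_C2_U] by (auto simp: u_x_def u_eq intro!: DERIV_imp_deriv)

lemma u_xx_eq: "t \<in> {0..1} \<Longrightarrow> u_xx M W f t = U2 t"
  using bounded_C2D(2)[OF bounded_C2_U] by (auto simp: u_xx_def u_x_eq intro!: DERIV_imp_deriv)

text \<open>The martingale property in discrete form: the variances 1/n and 1 - (k+1)/n add up to 1
  - k/n. A general F is allowed because it is applied to f and to both derivatives.\<close>

lemma smooth_U:
  assumes "k < n" and F: "exp_growth F"
  shows "smooth (sqrt (1 / real n)) (smooth (sqrt (1 - real (Suc k) / real n)) F)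
    = smooth (sqrt (1 - real k / real n)) F"
proof
  fix x
  have le: "real (Suc k) / real n \<le> 1" using assms by simp
  have "(sqrt (1 / real n))\<^sup>2 + (sqrt (1 - real (Suc k) / real n))\<^sup>2
      = 1 / real n + (1 - real (Suc k) / real n)"
    using le by simp
  also have "\<dots> = 1 - real k / real n" by (simp add: add_divide_distrib)
  finally have "sqrt ((sqrt (1 / real n))\<^sup>2 + (sqrt (1 - real (Suc k) / real n))\<^sup>2) = sqrt (1 - real k / real n)"
    by (rule arg_cong)
  moreover have "smooth (sqrt (1 / real n)) (smooth (sqrt (1 - real (Suc k) / real n)) F) x
      = smooth (sqrt ((sqrt (1 / real n))\<^sup>2 + (sqrt (1 - real (Suc k) / real n))\<^sup>2)) F x"
    using assms(1) le by (intro smooth_smooth F) (auto simp del: of_nat_Suc)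
  ultimately show "smooth (sqrt (1 / real n)) (smooth (sqrt (1 - real (Suc k) / real n)) F) x
      = smooth (sqrt (1 - real k / real n)) F x"
    by (simp only:)
qed

definition step_exponent :: "nat \<Rightarrow> nat \<Rightarrow> real \<Rightarrow> real \<Rightarrow> real" where
  "step_exponent n k = increment_exponent (sqrt (1 / real n)) (U (real (Suc k) / real n)) (U1 (real (Suc k) / real n))"

text \<open>The difference f (W 1) - u (0, 0) telescopes along the grid. By \<open>smooth_U\<close>,
  the value and the hedge ratio at time k/n are one-step averages of those at (k+1)/n, and the
  factor n is 1 / a^2.\<close>

lemma S_eq_sum:
  assumes n: "n \<ge> 1" and W0: "W 0 \<omega> = 0"
  shows "real n * S M W f n \<omega> = (\<Sum>k<n. step_exponent n k (W (real k / real n) \<omega>) (increment n k \<omega>))"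
proof -
  note g = bounded_C2_exp_growth[OF bounded_C2_f]
  let ?t = "\<lambda>k. real k / real n" and ?a = "sqrt (1 / real n)"
  have t: "?t k \<in> {0..1}" if "k \<le> n" for k
    using that by (auto simp: divide_le_eq)
  have step: "step_exponent n k (W (?t k) \<omega>) (increment n k \<omega>)
      = real n * ((U (?t (Suc k)) (W (?t (Suc k)) \<omega>) - U (?t k) (W (?t k) \<omega>))
        - u_x M W f (?t k) (W (?t k) \<omega>) * (W (?t (Suc k)) \<omega> - W (?t k) \<omega>))" if k: "k < n" for k
  proof -
    have "?a * increment n k \<omega> = W (?t (Suc k)) \<omega> - W (?t k) \<omega>"
      using n by (simp add: increment_def)
    then show ?thesis
      using n k t[of k] by (simp add: step_exponent_def increment_exponent_def smooth_U[OF k] g u_x_eq del: of_nat_Suc)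
  qed
  have "(\<Sum>k<n. step_exponent n k (W (?t k) \<omega>) (increment n k \<omega>))
      = real n * ((\<Sum>k<n. U (?t (Suc k)) (W (?t (Suc k)) \<omega>) - U (?t k) (W (?t k) \<omega>))
        - (\<Sum>k<n. u_x M W f (?t k) (W (?t k) \<omega>) * (W (?t (Suc k)) \<omega> - W (?t k) \<omega>)))"
    unfolding sum_subtractf[symmetric] sum_distrib_left by (intro sum.cong) (auto simp: step)
  also have "(\<Sum>k<n. U (?t (Suc k)) (W (?t (Suc k)) \<omega>) - U (?t k) (W (?t k) \<omega>)) = f (W 1 \<omega>) - u M W f 0 0"
    unfolding sum_lessThan_telescope[of "\<lambda>k. U (?t k) (W (?t k) \<omega>)"] using n W0 by (simp add: u_eq)
  finally show ?thesis by (simp add: S_def)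
qed

lemma step_exponent_measurable:
  "(\<lambda>p. ennreal (exp (step_exponent n k (fst p) (snd p)))) \<in> borel_measurable (borel \<Otimes>\<^sub>M borel)"
proof -
  have [measurable]: "(\<lambda>p. step_exponent n k (fst p) (snd p)) \<in> borel_measurable (borel \<Otimes>\<^sub>M borel)"
    unfolding step_exponent_def by (rule increment_exponent_measurable[OF bounded_C2_U])
  show ?thesis by measurable
qed

text \<open>The terminal weight is the constant 1 in the upper bound and the tent in the lower
  bound.\<close>

lemma nn_integral_exp_S:
  assumes n: "n \<ge> 1" and w: "\<And>k. w k \<in> borel_measurable borel"
  shows "(\<integral>\<^sup>+\<omega>. ennreal (exp (real n * S M W f n \<omega>)) * w n (W 1 \<omega>) \<partial>M)
    = (\<integral>\<^sup>+\<xi>. (\<Prod>k<n. ennreal (exp (step_exponent n k (sqrt (1 / real n) * (\<Sum>j<k. \<xi> j)) (\<xi> k))))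
        * w n (sqrt (1 / real n) * (\<Sum>j<n. \<xi> j)) \<partial>Pi\<^sub>M {..<n} (\<lambda>_. gauss))"
    (is "_ = (\<integral>\<^sup>+\<xi>. ?F \<xi> \<partial>_)")
proof -
  have F: "?F \<in> borel_measurable (Pi\<^sub>M {..<n} (\<lambda>_. gauss))"
    by (rule gauss_product_measurable[OF step_exponent_measurable w])
  have "(\<integral>\<^sup>+\<omega>. ennreal (exp (real n * S M W f n \<omega>)) * w n (W 1 \<omega>) \<partial>M)
      = (\<integral>\<^sup>+\<omega>. ?F (\<lambda>k\<in>{..<n}. increment n k \<omega>) \<partial>M)"
  proof (rule nn_integral_cong_AE)
    show "AE \<omega> in M. ennreal (exp (real n * S M W f n \<omega>)) * w n (W 1 \<omega>) = ?F (\<lambda>k\<in>{..<n}. increment n k \<omega>)"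
      using start_zero
    proof eventually_elim
      case (elim \<omega>)
      let ?\<xi> = "\<lambda>k\<in>{..<n}. increment n k \<omega>"
      have walk: "sqrt (1 / real n) * (\<Sum>j<k. ?\<xi> j) = W (real k / real n) \<omega>" if "k \<le> n" for k
      proof -
        have "(\<Sum>j<k. ?\<xi> j) = (\<Sum>j<k. increment n j \<omega>)" using that by (intro sum.cong) auto
        then show ?thesis using walk_increment[OF n elim, of k] by simp
      qed
      have "(\<Prod>k<n. ennreal (exp (step_exponent n k (sqrt (1 / real n) * (\<Sum>j<k. ?\<xi> j)) (?\<xi> k))))
          = (\<Prod>k<n. ennreal (exp (step_exponent n k (W (real k / real n) \<omega>) (increment n k \<omega>))))"
        using walk by (intro prod.cong) auto
      also have "\<dots> = ennreal (exp (real n * S M W f n \<omega>))"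
        by (simp add: S_eq_sum[OF n elim] exp_sum prod_ennreal)
      finally show ?case using walk[of n] n by simp
    qed
  qed
  then show ?thesis using nn_integral_increments[OF n F] by simp
qed

text \<open>Every constant is the Lipschitz constant of \<open>\<Psi>\<close> below c times a bound
  for u_xx. The upper bound compares with \<open>\<Psi> 0\<close>, which is where 0 <= c is used;
  the time modulus comes from |sqrt (1 - s) - sqrt (1 - t)| <= sqrt |s - t|.\<close>

sublocale running_reward "\<lambda>t x. \<Psi> (U2 t x)" "(1 + 1 / (1 - c)) / 2 * K" "(1 + 1 / (1 - c)) / 2 * B"
  "(1 + 1 / (1 - c)) / 2 * (B * gauss_moment)"
proof
  let ?l = "(1 + 1 / (1 - c)) / 2"
  have l: "0 \<le> ?l" using c by simp
  note n = bounded_C2D[OF bounded_C2_U]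
  have \<Psi>_0: "\<Psi> 0 = 0" by (simp add: \<Psi>_def)
  fix s t x y :: real
  show "0 \<le> \<Psi> (U2 t x)"
    using n(4)[of t x] c by (intro \<Psi>_nonneg) simp
  have "\<bar>\<Psi> (U2 t x) - \<Psi> 0\<bar> \<le> ?l * \<bar>U2 t x - 0\<bar>"
    using n(4)[of t x] c by (intro \<Psi>_lipschitz) auto
  also have "\<dots> \<le> ?l * K" using n(3)[of t x] l by (intro mult_left_mono) auto
  finally show "\<Psi> (U2 t x) \<le> ?l * K"
    using abs_ge_self[of "\<Psi> (U2 t x)"] \<Psi>_0 by simp
  have "\<bar>\<Psi> (U2 t x) - \<Psi> (U2 t y)\<bar> \<le> ?l * \<bar>U2 t x - U2 t y\<bar>"
    using n(4)[of t x] n(4)[of t y] c by (intro \<Psi>_lipschitz) auto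
  also have "\<dots> \<le> ?l * (B * \<bar>x - y\<bar>)" using n(5)[of t x y] l by (intro mult_left_mono) auto
  finally show "\<bar>\<Psi> (U2 t x) - \<Psi> (U2 t y)\<bar> \<le> ?l * B * \<bar>x - y\<bar>" by simp
  assume st: "s \<in> {0..1}" "t \<in> {0..1}"
  have root: "sqrt (1 - s) - sqrt (1 - t) \<le> sqrt \<bar>s - t\<bar>" if "s \<in> {0..1}" "t \<in> {0..1}" for s t
  proof -
    have "sqrt (1 - s) \<le> sqrt ((1 - t) + \<bar>s - t\<bar>)" by simp
    also have "\<dots> \<le> sqrt (1 - t) + sqrt \<bar>s - t\<bar>" using that by (intro sqrt_add_le_add_sqrt) auto
    finally show ?thesis by simp
  qed
  have "\<bar>\<Psi> (U2 s x) - \<Psi> (U2 t x)\<bar> \<le> ?l * \<bar>U2 s x - U2 t x\<bar>"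
    using n(4)[of t x] n(4)[of s x] c by (intro \<Psi>_lipschitz) auto
  also have "\<dots> \<le> ?l * (B * gauss_moment * \<bar>sqrt (1 - s) - sqrt (1 - t)\<bar>)"
    by (intro mult_left_mono smooth_scale_lipschitz[OF bounded_C2_f] l)
  also have "\<dots> \<le> ?l * (B * gauss_moment * sqrt \<bar>s - t\<bar>)"
    using root[OF st] root[OF st(2,1)] n(7) gauss_moment_ge_1
    by (intro mult_left_mono l) (auto simp: abs_le_iff abs_minus_commute)
  finally show "\<bar>\<Psi> (U2 s x) - \<Psi> (U2 t x)\<bar> \<le> ?l * (B * gauss_moment) * sqrt \<bar>s - t\<bar>" by simp
qed

lemma g_eq_best: "t \<in> {0..1} \<Longrightarrow> g M W f t = best t"
  by (simp add: g_def best_def u_xx_eq)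

lemma grid_in_unit_interval: "k \<le> n \<Longrightarrow> real k / real n \<in> {0..1}"
  by (auto simp: divide_le_eq)

lemma sum_inverse_sqrt: "(\<Sum>k<n. C * sqrt (1 / real n)) = C * sqrt (real n)"
proof -
  have "real n * sqrt (1 / real n) = sqrt (real n)" by (simp add: real_sqrt_divide real_div_sqrt)
  then show ?thesis by (simp add: mult.left_commute del: real_sqrt_divide)
qed

section \<open>Upper and lower bounds for the exponential moment\<close>

lemma exp_S_upper:
  "\<exists>C. \<forall>n\<ge>1. (\<integral>\<^sup>+\<omega>. ennreal (exp (real n * S M W f n \<omega>)) \<partial>M)
    \<le> ennreal (exp ((\<Sum>k<n. best (real k / real n)) + C * sqrt (real n)))"
proof -
  obtain C where C: "\<And>q q1 q2 a x. bounded_C2 K c B q q1 q2 \<Longrightarrow> 0 < a \<Longrightarrow> a \<le> 1 \<Longrightarrow>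
      integrable gauss (\<lambda>y. exp (increment_exponent a q q1 x y)) \<and>
      (\<integral>y. exp (increment_exponent a q q1 x y) \<partial>gauss) \<le> exp (\<Psi> (smooth a q2 x) + C * a)"
    using one_step_upper[OF c(2)] by blast
  have "(\<integral>\<^sup>+\<omega>. ennreal (exp (real n * S M W f n \<omega>)) \<partial>M)
    \<le> ennreal (exp ((\<Sum>k<n. best (real k / real n)) + C * sqrt (real n)))" if n: "n \<ge> 1" for n
  proof -
    let ?a = "sqrt (1 / real n)"
    have a: "0 < ?a" "?a \<le> 1" using n by auto
    have step: "(\<integral>\<^sup>+y. ennreal (exp (step_exponent n k x y)) * 1 \<partial>gauss)
        \<le> ennreal (exp (best (real k / real n) + C * ?a)) * 1" if k: "k < n" for k x
    proof -
      have b: "integrable gauss (\<lambda>y. exp (step_exponent n k x y))"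
          "(\<integral>y. exp (step_exponent n k x y) \<partial>gauss) \<le> exp (\<Psi> (U2 (real k / real n) x) + C * ?a)"
        using C[OF bounded_C2_U a, of "real (Suc k) / real n" x] smooth_U[OF k bounded_C2_exp_growth(3)[OF bounded_C2_f]]
        by (auto simp: step_exponent_def)
      have "\<Psi> (U2 (real k / real n) x) \<le> best (real k / real n)"
        using k by (intro P_le_best grid_in_unit_interval) auto
      then have "exp (\<Psi> (U2 (real k / real n) x) + C * ?a) \<le> exp (best (real k / real n) + C * ?a)"
        by simp
      from order_trans[OF b(2) this] b(1) show ?thesis by (simp add: nn_integral_eq_integral)
    qed
    have "(\<integral>\<^sup>+\<omega>. ennreal (exp (real n * S M W f n \<omega>)) * 1 \<partial>M)
        \<le> (\<Prod>k<n. ennreal (exp (best (real k / real n) + C * ?a))) * 1"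
      unfolding nn_integral_exp_S[OF n, of "\<lambda>_ _. 1", OF borel_measurable_const]
      by (rule gauss_product_upper[OF step_exponent_measurable, where w = "\<lambda>_ _. 1"]) (use step in auto)
    also have "\<dots> = ennreal (exp ((\<Sum>k<n. best (real k / real n)) + C * sqrt (real n)))"
      by (simp add: prod_ennreal sum.distrib sum_inverse_sqrt flip: exp_sum del: sum_constant)
    finally show ?thesis by simp
  qed
  then show ?thesis by blast
qed

text \<open>A tent that moves with \<gamma> is a subsolution with factors exp (\<open>\<Psi>\<close>
  on the path - d - C n^(-1/2)): d covers the variation of \<open>\<Psi>\<close> across the tube,
  the last term the confinement, the motion and the Taylor error.\<close>

lemma exp_S_lower:
  assumes \<gamma>: "\<And>s t. \<bar>\<gamma> s - \<gamma> t\<bar> \<le> A * \<bar>s - t\<bar>" and A: "A \<ge> 0" and \<gamma>0: "\<gamma> 0 = 0" and d: "d > 0"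
  shows "\<exists>C. \<forall>\<^sub>F n in sequentially.
    ennreal (exp ((\<Sum>k<n. \<Psi> (U2 (real k / real n) (\<gamma> (real k / real n)))) - real n * d - C * sqrt (real n)))
      \<le> (\<integral>\<^sup>+\<omega>. ennreal (exp (real n * S M W f n \<omega>)) \<partial>M)"
proof -
  define l where "l = (1 + 1 / (1 - c)) / 2 * B"
  have l: "0 \<le> l" using c bounded_C2D(7)[OF bounded_C2_f] by (simp add: l_def)
  \<comment> \<open>Tube radius, chosen so that the reward varies by at most d between the centre
    and any point of the tube; the +1 covers l = 0.\<close>
  define e where "e = d / (l + 1)"
  have e: "e > 0" using d l by (simp add: e_def)
  have le: "l * e \<le> d" using d l by (simp add: e_def field_simps)
  obtain C where C0: "C \<ge> 0" and C: "\<And>q q1 q2 a x r b. bounded_C2 K c B q q1 q2 \<Longrightarrow> 0 < a \<Longrightarrow> a \<le> 1 \<Longrightarrow> C * a \<le> 1 \<Longrightarrow>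
    \<bar>b\<bar> \<le> A * a \<Longrightarrow> tent e r * exp (\<Psi> (smooth a q2 x) - C * a)
      \<le> (\<integral>y. exp (increment_exponent a q q1 x y) * tent e (r + a * (y - b)) \<partial>gauss)"
    using one_step_lower[OF c(2) e A, of K B] by blast
  \<comment> \<open>The one-step bound requires C a <= 1, which is why the estimate holds only for
    large n.\<close>
  have "(\<lambda>n. C * sqrt (1 / real n)) \<longlonglongrightarrow> 0" by real_asymp
  then have "\<forall>\<^sub>F n in sequentially. C * sqrt (1 / real n) < 1"
    by (rule order_tendstoD) simp
  then have "\<forall>\<^sub>F n in sequentially.
    ennreal (exp ((\<Sum>k<n. \<Psi> (U2 (real k / real n) (\<gamma> (real k / real n)))) - real n * d - C * sqrt (real n)))
      \<le> (\<integral>\<^sup>+\<omega>. ennreal (exp (real n * S M W f n \<omega>)) \<partial>M)"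
    using eventually_ge_at_top[of 1]
  proof eventually_elim
    case (elim n)
    let ?a = "sqrt (1 / real n)" and ?t = "\<lambda>k. real k / real n"
    let ?P = "\<lambda>k. \<Psi> (U2 (?t k) (\<gamma> (?t k)))"
    have n: "n \<ge> 1" by fact
    have a: "0 < ?a" "?a \<le> 1" "?a * ?a = 1 / real n" using n by auto
    define w where "w k x = ennreal (tent e (x - \<gamma> (?t k)))" for k x
    have w: "w k \<in> borel_measurable borel" for k unfolding w_def by measurable
    have step: "ennreal (exp (?P k - d - C * ?a)) * w k x
        \<le> (\<integral>\<^sup>+y. ennreal (exp (step_exponent n k x y)) * w (Suc k) (x + ?a * y) \<partial>gauss)"
      if k: "k < n" for k x
    proof (cases "e \<le> \<bar>x - \<gamma> (?t k)\<bar>")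
      case True
      then show ?thesis using e by (simp add: w_def tent_zero)
    next
      case False
      \<comment> \<open>Motion of the centre in units of the increment's standard deviation: at most
        A a^2 / a = A a.\<close>
      define b where "b = (\<gamma> (?t (Suc k)) - \<gamma> (?t k)) / ?a"
      have ab: "?a * b = \<gamma> (?t (Suc k)) - \<gamma> (?t k)" using a by (simp add: b_def)
      have "?a * \<bar>b\<bar> = \<bar>?a * b\<bar>" using a(1) by (simp only: abs_mult abs_of_pos)
      also have "\<dots> \<le> A * \<bar>?t (Suc k) - ?t k\<bar>" unfolding ab by (rule \<gamma>)
      also have "\<dots> = ?a * (A * ?a)" using n a(3) by (simp add: add_divide_distrib mult.left_commute)
      finally have b: "\<bar>b\<bar> \<le> A * ?a" using a(1) by (rule mult_left_le_imp_le)
      have arg: "x - \<gamma> (?t k) + ?a * (y - b) = x + ?a * y - \<gamma> (?t (Suc k))" for y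
        using ab by (simp add: algebra_simps)
      have tk: "?t k \<in> {0..1}" using k by (intro grid_in_unit_interval) auto
      have "\<bar>\<Psi> (U2 (?t k) x) - ?P k\<bar> \<le> l * \<bar>x - \<gamma> (?t k)\<bar>"
        unfolding l_def by (rule P_lipschitz[OF tk])
      also have "\<dots> \<le> l * e" using False l by (intro mult_left_mono) auto
      finally have Pk: "?P k - d \<le> \<Psi> (U2 (?t k) x)" using le by linarith
      let ?F = "\<lambda>y. exp (step_exponent n k x y) * tent e (x + ?a * y - \<gamma> (?t (Suc k)))"
      have "tent e (x - \<gamma> (?t k)) * exp (?P k - d - C * ?a)
          \<le> tent e (x - \<gamma> (?t k)) * exp (\<Psi> (U2 (?t k) x) - C * ?a)"
        using Pk by (intro mult_left_mono tent_bounds) auto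
      also have "\<dots> \<le> (\<integral>y. ?F y \<partial>gauss)"
        using C[OF bounded_C2_U a(1,2) _ b, of "x - \<gamma> (?t k)" "?t (Suc k)" x] elim(1)
          smooth_U[OF k bounded_C2_exp_growth(3)[OF bounded_C2_f]]
        by (simp add: step_exponent_def arg del: of_nat_Suc)
      finally have le_int: "tent e (x - \<gamma> (?t k)) * exp (?P k - d - C * ?a) \<le> (\<integral>y. ?F y \<partial>gauss)" .
      have "integrable gauss (\<lambda>y. exp (step_exponent n k x y))"
        using one_step_upper[OF c(2), of K B] bounded_C2_U[of "?t (Suc k)"] a(1,2) unfolding step_exponent_def by blast
      moreover have [measurable]: "step_exponent n k x \<in> borel_measurable borel"
        unfolding step_exponent_def by (rule increment_exponent_measurable'[OF bounded_C2_U])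
      ultimately have "integrable gauss ?F"
        by (rule_tac Bochner_Integration.integrable_bound)
           (use tent_bounds e in \<open>auto simp: abs_mult intro!: mult_left_le\<close>)
      then have "ennreal (\<integral>y. ?F y \<partial>gauss) = (\<integral>\<^sup>+y. ennreal (?F y) \<partial>gauss)"
        by (intro nn_integral_eq_integral[symmetric]) (auto simp: tent_bounds)
      then have "ennreal (tent e (x - \<gamma> (?t k)) * exp (?P k - d - C * ?a)) \<le> (\<integral>\<^sup>+y. ennreal (?F y) \<partial>gauss)"
        using ennreal_leI[OF le_int] by simp
      then show ?thesis
        by (simp add: w_def ennreal_mult tent_bounds mult.commute del: of_nat_Suc)
    qed
    have "ennreal (exp ((\<Sum>k<n. ?P k) - real n * d - C * sqrt (real n)))
        = (\<Prod>k<n. ennreal (exp (?P k - d - C * ?a))) * w 0 0"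
    proof -
      have "(\<Sum>k<n. ?P k - d - C * ?a) = (\<Sum>k<n. ?P k) - real n * d - C * sqrt (real n)"
        unfolding sum_subtractf sum_inverse_sqrt by simp
      then show ?thesis
        by (simp add: w_def \<gamma>0 prod_ennreal flip: exp_sum)
    qed
    also have "\<dots> \<le> (\<integral>\<^sup>+\<omega>. ennreal (exp (real n * S M W f n \<omega>)) * w n (W 1 \<omega>) \<partial>M)"
      unfolding nn_integral_exp_S[where w = w, OF n w]
      by (rule gauss_product_lower[where w = w, OF step_exponent_measurable w]) (rule step)
    \<comment> \<open>The terminal tent is at most 1, so the constraint may be dropped.\<close>
    also have "\<dots> \<le> (\<integral>\<^sup>+\<omega>. ennreal (exp (real n * S M W f n \<omega>)) * 1 \<partial>M)"
      using tent_bounds(2)[OF e] by (intro nn_integral_mono mult_left_mono) (auto simp: w_def)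
    finally show ?case by simp
  qed
  then show ?thesis by blast
qed

lemma S_measurable:
  assumes n: "n \<ge> 1"
  shows "S M W f n \<in> borel_measurable M"
proof -
  have [measurable]: "W (real k / real n) \<in> borel_measurable M" "W (real (k + 1) / real n) \<in> borel_measurable M"
      "W 1 \<in> borel_measurable M" for k
    by (auto intro!: random_variable_W divide_nonneg_nonneg)
  have "U1 t \<in> borel_measurable borel" for t
    by (intro exp_growth_measurable bounded_C2_exp_growth(2)[OF bounded_C2_U])
  then have [measurable]: "u_x M W f (real k / real n) \<in> borel_measurable borel" if "k < n" for k
    using that by (subst u_x_eq) (auto intro!: grid_in_unit_interval simp: less_imp_le divide_le_eq)
  have [measurable]: "f \<in> borel_measurable borel"
    by (intro exp_growth_measurable bounded_C2_exp_growth(1)[OF bounded_C2_f])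
  show ?thesis
    unfolding S_def
    by (intro borel_measurable_diff borel_measurable_sum borel_measurable_times)
       (auto intro!: random_variable_W divide_nonneg_nonneg)
qed

lemma exp_S_integrable:
  assumes n: "n \<ge> 1"
  shows "integrable M (\<lambda>\<omega>. exp (real n * S M W f n \<omega>))"
proof -
  note [measurable] = S_measurable[OF n]
  obtain C where "(\<integral>\<^sup>+\<omega>. ennreal (exp (real n * S M W f n \<omega>)) \<partial>M)
    \<le> ennreal (exp ((\<Sum>k<n. best (real k / real n)) + C * sqrt (real n)))"
    using exp_S_upper n by blast
  then have "(\<integral>\<^sup>+\<omega>. ennreal (exp (real n * S M W f n \<omega>)) \<partial>M) < \<infinity>"
    by (rule order_le_less_trans) simp
  then show ?thesis by (intro integrableI_nonneg) auto
qed

theorem log_moment_rate: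
  "(\<lambda>n. 1 / real n * ln (\<integral>\<omega>. exp (real n * S M W f n \<omega>) \<partial>M)) \<longlonglongrightarrow> integral {0..1} best"
proof -
  let ?E = "\<lambda>n. \<integral>\<omega>. exp (real n * S M W f n \<omega>) \<partial>M"
  have nn: "(\<integral>\<^sup>+\<omega>. ennreal (exp (real n * S M W f n \<omega>)) \<partial>M) = ennreal (?E n)" if "n \<ge> 1" for n
    using exp_S_integrable[OF that] by (intro nn_integral_eq_integral) auto
  have pos: "?E n > 0" if "n \<ge> 1" for n
  proof (rule ccontr)
    assume "\<not> ?E n > 0"
    moreover have "?E n \<ge> 0" by simp
    ultimately have "?E n = 0" by linarith
    then have "AE \<omega> in M. exp (real n * S M W f n \<omega>) = 0"
      using exp_S_integrable[OF that] by (subst (asm) integral_nonneg_eq_0_iff_AE) auto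
    then show False by simp
  qed
  obtain C where C: "\<And>n. n \<ge> 1 \<Longrightarrow> (\<integral>\<^sup>+\<omega>. ennreal (exp (real n * S M W f n \<omega>)) \<partial>M)
    \<le> ennreal (exp ((\<Sum>k<n. best (real k / real n)) + C * sqrt (real n)))"
    using exp_S_upper by blast
  show ?thesis
  proof (rule log_rate_tendsto)
    fix n :: nat assume n: "n \<ge> 1"
    have "?E n \<le> exp ((\<Sum>k<n. best (real k / real n)) + C * sqrt (real n))"
      using C[OF n] unfolding nn[OF n] by (simp add: ennreal_le_iff)
    then have "ln (?E n) \<le> ln (exp ((\<Sum>k<n. best (real k / real n)) + C * sqrt (real n)))"
      using pos[OF n] by (subst ln_le_cancel_iff) auto
    then show "ln (?E n) \<le> (\<Sum>k<n. best (real k / real n)) + C * sqrt (real n)"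
      by simp
  next
    fix \<gamma> :: "real \<Rightarrow> real" and A d :: real
    assume "\<And>s t. \<bar>\<gamma> s - \<gamma> t\<bar> \<le> A * \<bar>s - t\<bar>" "A \<ge> 0" "\<gamma> 0 = 0" "d > 0"
    then obtain C where C: "\<forall>\<^sub>F n in sequentially.
      ennreal (exp ((\<Sum>k<n. \<Psi> (U2 (real k / real n) (\<gamma> (real k / real n)))) - real n * d - C * sqrt (real n)))
        \<le> (\<integral>\<^sup>+\<omega>. ennreal (exp (real n * S M W f n \<omega>)) \<partial>M)"
      using exp_S_lower by blast
    have "\<forall>\<^sub>F n in sequentially. (\<Sum>k<n. \<Psi> (U2 (real k / real n) (\<gamma> (real k / real n)))) - real n * d - C * sqrt (real n) \<le> ln (?E n)"
      using C eventually_ge_at_top[of 1]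
    proof eventually_elim
      case (elim n)
      have "exp ((\<Sum>k<n. \<Psi> (U2 (real k / real n) (\<gamma> (real k / real n)))) - real n * d - C * sqrt (real n)) \<le> ?E n"
        using elim(1) unfolding nn[OF elim(2)] by (simp add: ennreal_le_iff)
      then show ?case using pos[OF elim(2)] by (simp only: ln_ge_iff)
    qed
    then show "\<exists>C. \<forall>\<^sub>F n in sequentially. (\<Sum>k<n. \<Psi> (U2 (real k / real n) (\<gamma> (real k / real n)))) - real n * d - C * sqrt (real n) \<le> ln (?E n)"
      by blast
  qed
qed

end

text \<open>The two integrability claims are part of the content: a non-integrable function has
  integral 0 by convention, so without them the limit could hold for the wrong reason.\<close>

theorem theorem1p1:
  fixes M :: "'a measure" and W :: "real \<Rightarrow> 'a \<Rightarrow> real" and f :: "real \<Rightarrow> real"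
  assumes "standard_brownian_motion M W"
    and "C_class 3 f"
    and "bounded (range ((deriv ^^ 2) f))"
    and "(SUP x. (deriv ^^ 2) f x) < 1"
    and "\<exists>L. L-lipschitz_on UNIV ((deriv ^^ 3) f)"
  shows "(\<forall>n\<ge>1. integrable M (\<lambda>\<omega>. exp (real n * S M W f n \<omega>))) \<and>
    set_integrable lborel {0..1} (g M W f) \<and>
    (\<lambda>n. 1 / real n * ln (\<integral>\<omega>. exp (real n * S M W f n \<omega>) \<partial>M))
      \<longlonglongrightarrow> (LBINT t:{0..1}. g M W f t)"
proof -
  let ?f1 = "deriv f" and ?f2 = "(deriv ^^ 2) f" and ?f3 = "(deriv ^^ 3) f"
  have deriv: "((deriv ^^ i) f has_field_derivative (deriv ^^ Suc i) f x) (at x)" if "i < 3" for i x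
    using assms(2) that by (auto simp: C_class_def intro!: field_differentiable_derivI)
  obtain K where K: "\<And>x. \<bar>?f2 x\<bar> \<le> K"
    using assms(3) by (auto simp: bounded_iff)
  obtain L where L: "L-lipschitz_on UNIV ?f3" using assms(5) by blast
  have L0: "L \<ge> 0" by (rule lipschitz_on_nonneg[OF L])
  have D2: "(?f2 has_field_derivative ?f3 x) (at x)" for x
    using deriv[of 2 x] by (simp add: numeral_3_eq_3 numeral_2_eq_2)
  \<comment> \<open>Since |f''| <= K, the mean value theorem on [x, x + 1] gives a point with |f'''|
    <= 2 K; the Lipschitz condition adds at most L. Hence f'' is Lipschitz with constant 2 K +
    L.\<close>
  have f3: "\<bar>?f3 x\<bar> \<le> 2 * K + L" for x
  proof -
    obtain z where z: "x < z" "z < x + 1" "?f2 (x + 1) - ?f2 x = (x + 1 - x) * ?f3 z"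
      using MVT2[of x "x + 1" ?f2 ?f3] D2 by auto
    have "\<bar>?f3 z\<bar> \<le> 2 * K" using z(3) K[of x] K[of "x + 1"] by simp
    moreover have "\<bar>?f3 x - ?f3 z\<bar> \<le> L * \<bar>x - z\<bar>"
      using lipschitz_onD[OF L, of x z] by (simp add: dist_real_def)
    moreover have "L * \<bar>x - z\<bar> \<le> L * 1" using z L0 by (intro mult_left_mono) auto
    ultimately show ?thesis by linarith
  qed
  \<comment> \<open>Truncation at 0 supplies 0 <= c, and c < 1 is preserved.\<close>
  define c where "c = max 0 (SUP x. ?f2 x)"
  have "bdd_above (range ?f2)" using assms(3) by (rule bounded_imp_bdd_above)
  then have c: "?f2 x \<le> c" for x
    unfolding c_def by (intro max.coboundedI2 cSUP_upper) auto
  have lip: "\<bar>?f2 x - ?f2 y\<bar> \<le> (2 * K + L) * \<bar>x - y\<bar>" for x y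
    using field_differentiable_bound[of UNIV ?f2 ?f3 "2 * K + L" x y] D2 f3 by simp
  have "bounded_C2 K c (2 * K + L) f ?f1 ?f2"
    unfolding bounded_C2_def
    using deriv[of 0] deriv[of 1] K c lip by (auto simp: numeral_2_eq_2)
  then interpret hedged_claim M W f ?f1 ?f2 K c "2 * K + L"
    using assms(1,4) by (auto simp: hedged_claim_def hedged_claim_axioms_def c_def)
  have int: "set_integrable lborel {0..1} (g M W f)"
    using set_lebesgue_integral_01(1)[OF continuous_on_best]
    by (subst set_integrable_cong[OF refl refl g_eq_best]) auto
  have "(LBINT t:{0..1}. g M W f t) = (LBINT t:{0..1}. best t)"
    by (intro set_lebesgue_integral_cong) (auto intro: g_eq_best)
  also have "\<dots> = integral {0..1} best"
    by (rule set_lebesgue_integral_01(2)[OF continuous_on_best])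
  finally show ?thesis
    using exp_S_integrable int log_moment_rate by simp
qed

end
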